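(* Let $(X_j)_{j\ge 1}$ and $(\nu_n)_{n\ge 1}$ be as in the context. Then: (i) If the random Rotar condition $$\lim_{n\to\infty}\mathbb{E}\Big\{\frac{1}{B_{\nu_n}}\sum_{j=1}^{\nu_n}\int_{|x|>\epsilon B_{\nu_n}}|x|\,|F_j(x)-\Phi_j(x)|\,dx\Big\}=0\quad\text{for every }\epsilon>0$$ holds, then the random central limit theorem holds, i.e. $\lim_{n\to\infty}\Delta_{\nu_n}=0$. (ii) If the random Feller condition $$\lim_{n\to\infty}\mathbb{E}\Big\{\frac{1}{B_{\nu_n}^2}\max_{1\le j\le \nu_n}\sigma_j^2\Big\}=0$$ holds and $\lim_{n\to\infty}\Delta_{\nu_n}=0$, then the random Rotar condition $$\lim_{n\to\infty}\mathbb{E}\Big\{\frac{1}{B_{\nu_n}}\sum_{j=1}^{\nu_n}\int_{|x|>\epsilon B_{\nu_n}}|x|\,|F_j(x)-\Phi_j(x)|\,dx\Big\}=0\quad\text{for every }\epsilon>0$$ holds.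
   Context: $(X_j)_{j\ge1}$ is a sequence of independent (not necessarily identically distributed) real random variables on a probability space $(\Omega,\mathcal{A},\mathbb{P})$ with $\mathbb{E}X_j=0$ and variance $\mathbb{D}X_j=\sigma_j^2\in(0,+\infty)$. Put $S_n=\sum_{j=1}^n X_j$, $B_n^2=\sum_{j=1}^n\sigma_j^2$, $B_n>0$, and assume $B_n\to\infty$ as $n\to\infty$. Let $(\nu_n)_{n\ge1}$ be positive integer-valued random variables such that for each $n$ the variables $\nu_n,X_1,X_2,\dots$ are independent, and $\nu_n\to+\infty$ in probability. Put $S_{\nu_n}=\sum_{j=1}^{\nu_n}X_j$ and $B_{\nu_n}^2=\sum_{j=1}^{\nu_n}\sigma_j^2$ (random variables, $B_{\nu_n}$ being $B_k$ on $\{\nu_n=k\}$); assume $B_{\nu_n}>0$ almost surely and $B_{\nu_n}\to\infty$ in probability. Let $F_j(x)=\mathbb{P}(X_j<x)$, let $\Phi_{0,1}$ be the standard normal distribution function, $\Phi_j(x)=\Phi_{0,1}(x/\sigma_j)$, and $$\Delta_{\nu_n}=\sup_{x\in\mathbb{R}}\Big|\mathbb{P}\Big(\frac{S_{\nu_n}}{B_{\nu_n}}<x\Big)-\Phi_{0,1}(x)\Big|.$$ For an expression $g(k)$ depending on an integer $k$, $\mathbb{E}\{g(\nu_n)\}=\sum_{k\ge1}\mathbb{P}(\nu_n=k)g(k)$.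
   Formalization: The random Rotar condition is normalised by 1/B_{ν_n}^2 instead of the printed 1/B_{ν_n}; with 1/B_{ν_n} part (ii) is false (ν_n=n, i.i.d. symmetric X_j with P(|X_j|>x)=x^{-5/2} for x≥1 gives order n^{1/4}); part (i) as printed follows from the version proved. *)

theory Defs
  imports "HOL-Probability.Probability"
begin

text \<open>
  Sequences are indexed by \<^typ>\<open>nat\<close> but only the indices \<open>\<ge> 1\<close> are used.
\<close>

definition var :: "'a measure \<Rightarrow> ('a \<Rightarrow> real) \<Rightarrow> real" where
  "var M Y = prob_space.variance M Y"

definition S :: "(nat \<Rightarrow> 'a \<Rightarrow> real) \<Rightarrow> nat \<Rightarrow> 'a \<Rightarrow> real" where
  "S X n \<omega> = (\<Sum>j=1..n. X j \<omega>)"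

definition B :: "'a measure \<Rightarrow> (nat \<Rightarrow> 'a \<Rightarrow> real) \<Rightarrow> nat \<Rightarrow> real" where
  "B M X n = sqrt (\<Sum>j=1..n. var M (X j))"

text \<open>
  The distribution functions of the summands are the left-continuous ones (strict inequality),
  whereas \<^const>\<open>cdf\<close> is right-continuous; the normal law has no atoms, so for it the
  two conventions coincide.
\<close>

definition F :: "'a measure \<Rightarrow> (nat \<Rightarrow> 'a \<Rightarrow> real) \<Rightarrow> nat \<Rightarrow> real \<Rightarrow> real" where
  "F M X j x = measure M {\<omega> \<in> space M. X j \<omega> < x}"

definition Phi01 :: "real \<Rightarrow> real" where
  "Phi01 x = cdf std_normal_distribution x"

definition Phi :: "'a measure \<Rightarrow> (nat \<Rightarrow> 'a \<Rightarrow> real) \<Rightarrow> nat \<Rightarrow> real \<Rightarrow> real" where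
  "Phi M X j x = Phi01 (x / sqrt (var M (X j)))"

definition tends_to_infinity_in_prob :: "'a measure \<Rightarrow> (nat \<Rightarrow> 'a \<Rightarrow> real) \<Rightarrow> bool" where
  "tends_to_infinity_in_prob M Y \<longleftrightarrow>
     (\<forall>c. (\<lambda>n. measure M {\<omega> \<in> space M. Y n \<omega> > c}) \<longlonglongrightarrow> 1)"

text \<open>
  \<open>E{g(N)} = \<Sum>k\<ge>1. P(N = k) g(k)\<close> for a positive integer-valued \<open>N\<close>.
\<close>

definition expect_at :: "'a measure \<Rightarrow> ('a \<Rightarrow> nat) \<Rightarrow> (nat \<Rightarrow> real) \<Rightarrow> real" where
  "expect_at M N g = (\<Sum>k. measure M {\<omega> \<in> space M. N \<omega> = Suc k} * g (Suc k))"

text \<open>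
  The family \<open>N, X 1, X 2, \<dots>\<close> of different types is encoded as one real-valued family with
  \<open>N\<close> in position \<open>0\<close>; the embedding of \<^typ>\<open>nat\<close> into \<^typ>\<open>real\<close>
  does not change the generated sigma-algebra.
\<close>

definition indep_with_index :: "'a measure \<Rightarrow> ('a \<Rightarrow> nat) \<Rightarrow> (nat \<Rightarrow> 'a \<Rightarrow> real) \<Rightarrow> bool" where
  "indep_with_index M N X \<longleftrightarrow>
     prob_space.indep_vars M (\<lambda>_. borel) (\<lambda>j. if j = 0 then (\<lambda>\<omega>. real (N \<omega>)) else X j) UNIV"

definition Delta :: "'a measure \<Rightarrow> (nat \<Rightarrow> 'a \<Rightarrow> real) \<Rightarrow> ('a \<Rightarrow> nat) \<Rightarrow> real" where
  "Delta M X N =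
     (SUP x. \<bar>measure M {\<omega> \<in> space M. S X (N \<omega>) \<omega> / B M X (N \<omega>) < x} - Phi01 x\<bar>)"

text \<open>
  The normalisation is \<open>1 / B\<^sup>2\<close>. This is what Rotar's condition
  \<open>\<Sum>j\<le>k. \<integral>\<^bsub>|y|>\<epsilon>\<^esub> |y| |P(X j / B < y) - \<Phi>(y B / \<sigma> j)| dy\<close> for the normalised summands becomes
  under \<open>x = B y\<close>. With \<open>1 / B\<close> instead, necessity fails already for i.i.d. summands with a
  heavy tail and a deterministic index. If the summands have finite variance, the integrands are
  integrable and the value below is bounded in \<open>k\<close>, so that neither the integral nor the series
  \<open>expect_at\<close> takes its default value.
\<close>

definition rotar :: "'a measure \<Rightarrow> (nat \<Rightarrow> 'a \<Rightarrow> real) \<Rightarrow> real \<Rightarrow> nat \<Rightarrow> real" where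
  "rotar M X \<epsilon> k =
     1 / (B M X k)\<^sup>2 *
       (\<Sum>j=1..k. LINT x:{x. \<bar>x\<bar> > \<epsilon> * B M X k}|lborel. \<bar>x\<bar> * \<bar>F M X j x - Phi M X j x\<bar>)"

definition random_rotar_condition ::
    "'a measure \<Rightarrow> (nat \<Rightarrow> 'a \<Rightarrow> real) \<Rightarrow> (nat \<Rightarrow> 'a \<Rightarrow> nat) \<Rightarrow> bool" where
  "random_rotar_condition M X \<nu> \<longleftrightarrow>
     (\<forall>\<epsilon>>0. (\<lambda>n. expect_at M (\<nu> n) (rotar M X \<epsilon>)) \<longlonglongrightarrow> 0)"

definition random_feller_condition ::
    "'a measure \<Rightarrow> (nat \<Rightarrow> 'a \<Rightarrow> real) \<Rightarrow> (nat \<Rightarrow> 'a \<Rightarrow> nat) \<Rightarrow> bool" where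
  "random_feller_condition M X \<nu> \<longleftrightarrow>
     (\<lambda>n. expect_at M (\<nu> n) (\<lambda>k. 1 / (B M X k)\<^sup>2 * Max ((\<lambda>j. var M (X j)) ` {1..k}))) \<longlonglongrightarrow> 0"

end

theory Submission
  imports Defs
begin

text \<open>
  Write \<open>\<phi>\<^sub>k\<close> for the characteristic function of \<open>S\<^sub>k / B\<^sub>k\<close>, \<open>R\<^sub>k\<close> for the Rotar quantity at level
  \<open>\<epsilon>\<close>, and \<open>m\<^sub>k = max \<sigma>\<^sub>j\<^sup>2 / B\<^sub>k\<^sup>2\<close>. By independence the characteristic function of
  \<open>S\<^sub>\<nu> / B\<^sub>\<nu>\<close> is \<open>E \<phi>\<^sub>\<nu>\<close> (\<open>char_random_sum\<close>). Both implications come from inequalities for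
  a single fixed \<open>k\<close> in which \<open>R\<^sub>k\<close>, \<open>m\<^sub>k\<close> and \<open>\<phi>\<^sub>k\<close> occur linearly; such inequalities survive
  the expectation over the random index. The passage between
  \<open>\<Delta>\<close> and characteristic functions is the continuity theorem together with Polya's theorem
  (\<open>kolmogorov_dist_tendsto_0_iff\<close>).

  Sufficiency. For centred laws with equal variances, integration by parts turns
  \<open>E h(X) - E h(Y)\<close> into \<open>\<integral> h' (F\<^sub>Y - F\<^sub>X)\<close>. Taking for \<open>h\<close> the second order Taylor remainder of
  \<open>exp (i u x)\<close>, whose derivative is \<open>O(u\<^sup>3 x\<^sup>2)\<close> and also \<open>O(u\<^sup>2 |x|)\<close>, and comparing the
  summands with normal ones factor by factor, one obtains
  \<open>|\<phi>\<^sub>k(t) - exp (-t\<^sup>2/2)| \<le> 2 |t|\<^sup>3 \<epsilon> + 2 t\<^sup>2 R\<^sub>k\<close> (\<open>prod_char_diff_le\<close>).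

  Necessity. The difficulty is that a mixture might be nearly normal because deviations of its
  components cancel, and symmetrisation does not help since \<open>|E \<phi>\<^sub>\<nu>|\<^sup>2\<close> is not \<open>E |\<phi>\<^sub>\<nu>|\<^sup>2\<close>. The
  real part of \<open>\<phi>\<^sub>k(1)\<close>, however, can deviate from \<open>exp (-1/2)\<close> in only one direction, up to an
  error of order \<open>m\<^sub>k\<close>. Indeed \<open>\<phi>\<^sub>k(1)\<close> is within \<open>m\<^sub>k / 2\<close> of \<open>exp \<psi>\<close>, where \<open>\<psi>\<close> is the sum of the
  \<open>f\<^sub>j(1 / B\<^sub>k) - 1\<close> over the characteristic functions \<open>f\<^sub>j\<close> of the summands. Centring and the
  normalisation of the variance give \<open>\<psi> = -1/2 + d + i I\<close> with
  \<open>d = \<Sum> E q(X\<^sub>j / B\<^sub>k) \<ge> 0\<close> for \<open>q(y) = cos y - 1 + y\<^sup>2/2\<close>, and \<open>I\<close> the corresponding sum for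
  \<open>sin y - y\<close>. Since \<open>(sin y - y)\<^sup>2 \<le> y\<^sup>2 q(y)\<close>, the Cauchy-Schwarz inequality gives
  \<open>I\<^sup>2 \<le> d \<le> 1/2\<close>, whence \<open>Re (exp \<psi>) = exp (-1/2) exp d cos I \<ge> exp (-1/2) (1 + d/4)\<close>
  (\<open>Re_prod_char_ge\<close>). So if \<open>E Re \<phi>\<^sub>\<nu>(1)\<close> tends to \<open>exp (-1/2)\<close> and \<open>E m\<^sub>\<nu>\<close> to \<open>0\<close>, then \<open>E d\<close> tends
  to \<open>0\<close>. As \<open>q(y)\<close> is at least a multiple of \<open>y\<^sup>2\<close> where \<open>|y| > \<epsilon>\<close>, \<open>d\<close> dominates the Lindeberg
  sum, and this together with \<open>m\<^sub>k\<close> dominates \<open>R\<^sub>k\<close> (\<open>sum_cdf_gap_le\<close>).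
\<close>

section \<open>Gaps between distribution functions\<close>

text \<open>
  The left-continuous distribution function, matching the strict inequalities in
  \<^const>\<open>F\<close> and \<^const>\<open>Delta\<close>.
\<close>

definition lcdf :: "real measure \<Rightarrow> real \<Rightarrow> real" where
  "lcdf \<mu> x = measure \<mu> {..<x}"

text \<open>
  One summand of the Rotar sum, without the factor \<open>1 / B\<^sup>2\<close>. A negative \<open>a\<close> gives the integral over
  the whole line.
\<close>

definition cdf_gap :: "real measure \<Rightarrow> real measure \<Rightarrow> real \<Rightarrow> real" where
  "cdf_gap \<mu> \<gamma> a = (LINT x:{x. \<bar>x\<bar> > a}|lborel. \<bar>x\<bar> * \<bar>lcdf \<mu> x - lcdf \<gamma> x\<bar>)"

lemma borel_measurable_lcdf:
  assumes "real_distribution \<mu>"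
  shows "lcdf \<mu> \<in> borel_measurable borel"
proof -
  interpret real_distribution \<mu> by fact
  have "mono (lcdf \<mu>)"
    unfolding lcdf_def mono_def by (auto intro!: finite_measure_mono)
  then show ?thesis by (rule borel_measurable_mono)
qed

lemma nn_integral_abs_band_le:
  fixes a y :: real
  shows "(\<integral>\<^sup>+x. ennreal (\<bar>x\<bar> * indicator {x. a < \<bar>x\<bar> \<and> \<bar>x\<bar> \<le> \<bar>y\<bar>} x) \<partial>lborel)
         \<le> ennreal (2 * (y\<^sup>2 * indicator {y. a < \<bar>y\<bar>} y))"
proof -
  have "(\<integral>\<^sup>+x. ennreal (\<bar>x\<bar> * indicator {x. a < \<bar>x\<bar> \<and> \<bar>x\<bar> \<le> \<bar>y\<bar>} x) \<partial>lborel)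
      \<le> (\<integral>\<^sup>+x. ennreal (\<bar>y\<bar> * indicator {y. a < \<bar>y\<bar>} y) * indicator {-\<bar>y\<bar>..\<bar>y\<bar>} x \<partial>lborel)"
    by (intro nn_integral_mono) (auto split: split_indicator)
  also have "\<dots> = ennreal (\<bar>y\<bar> * indicator {y. a < \<bar>y\<bar>} y) * ennreal (2 * \<bar>y\<bar>)"
    by (subst nn_integral_cmult_indicator) auto
  also have "\<dots> = ennreal (2 * (y\<^sup>2 * indicator {y. a < \<bar>y\<bar>} y))"
    by (subst ennreal_mult[symmetric]) (auto split: split_indicator simp: power2_eq_square)
  finally show ?thesis .
qed

text \<open>
  The order of integration in \<open>E \<integral>\<^bsub>a < |x| \<le> |Y|\<^esub> |x| dx\<close> is exchanged. The sharp constant would be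
  \<open>1\<close>; bounding \<open>|x|\<close> by \<open>|Y|\<close> on the whole band is simpler and loses only a factor of two.
\<close>

lemma tail_layer_cake_le:
  assumes "real_distribution \<mu>" "integrable \<mu> (\<lambda>y. y\<^sup>2)"
  shows "(\<integral>\<^sup>+x. ennreal (\<bar>x\<bar> * indicator {x. a < \<bar>x\<bar>} x * measure \<mu> {y. \<bar>x\<bar> \<le> \<bar>y\<bar>}) \<partial>lborel)
         \<le> ennreal (2 * (LINT y|\<mu>. y\<^sup>2 * indicator {y. a < \<bar>y\<bar>} y))"
proof -
  interpret real_distribution \<mu> by fact
  interpret P: pair_sigma_finite \<mu> lborel
    by unfold_locales
  have int: "integrable \<mu> (\<lambda>y. 2 * (y\<^sup>2 * indicator {y. a < \<bar>y\<bar>} y))"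
    by (intro integrable_mult_right Bochner_Integration.integrable_bound[OF assms(2)])
       (auto split: split_indicator)
  have "(\<integral>\<^sup>+x. ennreal (\<bar>x\<bar> * indicator {x. a < \<bar>x\<bar>} x * measure \<mu> {y. \<bar>x\<bar> \<le> \<bar>y\<bar>}) \<partial>lborel)
      = (\<integral>\<^sup>+x. (\<integral>\<^sup>+y. ennreal (\<bar>x\<bar> * indicator {x. a < \<bar>x\<bar> \<and> \<bar>x\<bar> \<le> \<bar>y\<bar>} x) \<partial>\<mu>) \<partial>lborel)"
  proof (intro nn_integral_cong)
    fix x :: real
    have "(\<integral>\<^sup>+y. ennreal (\<bar>x\<bar> * indicator {x. a < \<bar>x\<bar> \<and> \<bar>x\<bar> \<le> \<bar>y\<bar>} x) \<partial>\<mu>)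
        = (\<integral>\<^sup>+y. ennreal (\<bar>x\<bar> * indicator {x. a < \<bar>x\<bar>} x) * indicator {y. \<bar>x\<bar> \<le> \<bar>y\<bar>} y \<partial>\<mu>)"
      by (intro nn_integral_cong) (auto split: split_indicator)
    also have "\<dots> = ennreal (\<bar>x\<bar> * indicator {x. a < \<bar>x\<bar>} x) * emeasure \<mu> {y. \<bar>x\<bar> \<le> \<bar>y\<bar>}"
      by (subst nn_integral_cmult_indicator) auto
    also have "\<dots> = ennreal (\<bar>x\<bar> * indicator {x. a < \<bar>x\<bar>} x * measure \<mu> {y. \<bar>x\<bar> \<le> \<bar>y\<bar>})"
      by (simp add: emeasure_eq_measure ennreal_mult'')
    finally show "ennreal (\<bar>x\<bar> * indicator {x. a < \<bar>x\<bar>} x * measure \<mu> {y. \<bar>x\<bar> \<le> \<bar>y\<bar>})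
        = (\<integral>\<^sup>+y. ennreal (\<bar>x\<bar> * indicator {x. a < \<bar>x\<bar> \<and> \<bar>x\<bar> \<le> \<bar>y\<bar>} x) \<partial>\<mu>)" by simp
  qed
  also have "\<dots> = (\<integral>\<^sup>+y. (\<integral>\<^sup>+x. ennreal (\<bar>x\<bar> * indicator {x. a < \<bar>x\<bar> \<and> \<bar>x\<bar> \<le> \<bar>y\<bar>} x) \<partial>lborel) \<partial>\<mu>)"
    by (rule P.Fubini') (auto simp: split_beta')
  also have "\<dots> \<le> (\<integral>\<^sup>+y. ennreal (2 * (y\<^sup>2 * indicator {y. a < \<bar>y\<bar>} y)) \<partial>\<mu>)"
    by (intro nn_integral_mono nn_integral_abs_band_le)
  also have "\<dots> = ennreal (LINT y|\<mu>. 2 * (y\<^sup>2 * indicator {y. a < \<bar>y\<bar>} y))"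
    using int by (intro nn_integral_eq_integral) (auto split: split_indicator)
  finally show ?thesis by simp
qed

text \<open>
  For positive \<open>x\<close> the two distribution functions are compared through their upper tails, otherwise
  through their lower tails.
\<close>

lemma abs_lcdf_diff_le:
  assumes "real_distribution \<mu>" "real_distribution \<gamma>"
  shows "\<bar>lcdf \<mu> x - lcdf \<gamma> x\<bar> \<le> measure \<mu> {y. \<bar>x\<bar> \<le> \<bar>y\<bar>} + measure \<gamma> {y. \<bar>x\<bar> \<le> \<bar>y\<bar>}"
proof -
  interpret m: real_distribution \<mu> by fact
  interpret g: real_distribution \<gamma> by fact
  show ?thesis
  proof (cases "x \<le> 0")
    case True
    then have "lcdf \<mu> x \<le> measure \<mu> {y. \<bar>x\<bar> \<le> \<bar>y\<bar>}" "lcdf \<gamma> x \<le> measure \<gamma> {y. \<bar>x\<bar> \<le> \<bar>y\<bar>}"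
      unfolding lcdf_def by (auto intro!: m.finite_measure_mono g.finite_measure_mono)
    moreover have "0 \<le> lcdf \<mu> x" "0 \<le> lcdf \<gamma> x" by (auto simp: lcdf_def)
    ultimately show ?thesis by linarith
  next
    case False
    have "1 - lcdf \<mu> x = measure \<mu> (space \<mu> - {..<x})"
      unfolding lcdf_def by (subst m.prob_compl) auto
    also have "\<dots> \<le> measure \<mu> {y. \<bar>x\<bar> \<le> \<bar>y\<bar>}"
      using False by (auto intro!: m.finite_measure_mono)
    finally have 1: "1 - lcdf \<mu> x \<le> measure \<mu> {y. \<bar>x\<bar> \<le> \<bar>y\<bar>}" .
    have "1 - lcdf \<gamma> x = measure \<gamma> (space \<gamma> - {..<x})"
      unfolding lcdf_def by (subst g.prob_compl) auto
    also have "\<dots> \<le> measure \<gamma> {y. \<bar>x\<bar> \<le> \<bar>y\<bar>}"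
      using False by (auto intro!: g.finite_measure_mono)
    finally have 2: "1 - lcdf \<gamma> x \<le> measure \<gamma> {y. \<bar>x\<bar> \<le> \<bar>y\<bar>}" .
    have "lcdf \<mu> x \<le> 1" "lcdf \<gamma> x \<le> 1" by (auto simp: lcdf_def)
    with 1 2 show ?thesis by linarith
  qed
qed

text \<open>
  These bounds make every integral in the Rotar condition a genuine one, and reduce the Rotar
  condition to truncated second moments, as in Lindeberg's condition.
\<close>

lemma cdf_gap_bound:
  assumes m: "real_distribution \<mu>" "integrable \<mu> (\<lambda>y. y\<^sup>2)"
    and g: "real_distribution \<gamma>" "integrable \<gamma> (\<lambda>y. y\<^sup>2)"
  shows "set_integrable lborel {x. a < \<bar>x\<bar>} (\<lambda>x. \<bar>x\<bar> * \<bar>lcdf \<mu> x - lcdf \<gamma> x\<bar>)"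
    and "cdf_gap \<mu> \<gamma> a \<le> 2 * (LINT y|\<mu>. y\<^sup>2 * indicator {y. a < \<bar>y\<bar>} y)
                            + 2 * (LINT y|\<gamma>. y\<^sup>2 * indicator {y. a < \<bar>y\<bar>} y)"
    and "0 \<le> cdf_gap \<mu> \<gamma> a"
proof -
  let ?f = "\<lambda>x. indicator {x. a < \<bar>x\<bar>} x * (\<bar>x\<bar> * \<bar>lcdf \<mu> x - lcdf \<gamma> x\<bar>)"
  let ?t = "\<lambda>\<nu> x. \<bar>x\<bar> * indicator {x. a < \<bar>x\<bar>} x * measure \<nu> {y. \<bar>x\<bar> \<le> \<bar>y\<bar>}"
  let ?I = "\<lambda>\<nu>. LINT y|\<nu>. y\<^sup>2 * indicator {y. a < \<bar>y\<bar>} y"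
  note [measurable] = borel_measurable_lcdf[OF m(1)] borel_measurable_lcdf[OF g(1)]
  have tail: "(\<lambda>x. measure \<nu> {y. \<bar>x\<bar> \<le> \<bar>y\<bar>}) \<in> borel_measurable borel" if "real_distribution \<nu>" for \<nu>
  proof -
    interpret real_distribution \<nu> by fact
    have "mono (\<lambda>x. - measure \<nu> {y. x \<le> \<bar>y\<bar>})"
      unfolding mono_def by (auto intro!: finite_measure_mono)
    from borel_measurable_mono[OF this]
    have [measurable]: "(\<lambda>x. measure \<nu> {y. x \<le> \<bar>y\<bar>}) \<in> borel_measurable borel"
      by (simp add: borel_measurable_uminus_eq)
    show ?thesis by measurable
  qed
  note [measurable] = tail[OF m(1)] tail[OF g(1)]
  have "(\<integral>\<^sup>+x. ennreal (?f x) \<partial>lborel) \<le> (\<integral>\<^sup>+x. ennreal (?t \<mu> x) + ennreal (?t \<gamma> x) \<partial>lborel)"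
  proof (intro nn_integral_mono)
    fix x
    have "?f x \<le> indicator {x. a < \<bar>x\<bar>} x * (\<bar>x\<bar> * (measure \<mu> {y. \<bar>x\<bar> \<le> \<bar>y\<bar>} + measure \<gamma> {y. \<bar>x\<bar> \<le> \<bar>y\<bar>}))"
      by (intro mult_left_mono abs_lcdf_diff_le m g) auto
    also have "\<dots> = ?t \<mu> x + ?t \<gamma> x" by (simp add: algebra_simps)
    finally have "ennreal (?f x) \<le> ennreal (?t \<mu> x + ?t \<gamma> x)" by (rule ennreal_leI)
    also have "\<dots> = ennreal (?t \<mu> x) + ennreal (?t \<gamma> x)" by (rule ennreal_plus) auto
    finally show "ennreal (?f x) \<le> ennreal (?t \<mu> x) + ennreal (?t \<gamma> x)" .
  qed
  also have "\<dots> = (\<integral>\<^sup>+x. ennreal (?t \<mu> x) \<partial>lborel) + (\<integral>\<^sup>+x. ennreal (?t \<gamma> x) \<partial>lborel)"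
    by (rule nn_integral_add) auto
  also have "\<dots> \<le> ennreal (2 * ?I \<mu>) + ennreal (2 * ?I \<gamma>)"
    by (intro add_mono tail_layer_cake_le m g)
  also have "\<dots> = ennreal (2 * ?I \<mu> + 2 * ?I \<gamma>)"
    by (subst ennreal_plus) auto
  finally have le: "(\<integral>\<^sup>+x. ennreal (?f x) \<partial>lborel) \<le> ennreal (2 * ?I \<mu> + 2 * ?I \<gamma>)" .
  have int: "integrable lborel ?f"
    by (rule integrableI_nonneg) (use le in \<open>auto simp: le_less_trans\<close>)
  then show "set_integrable lborel {x. a < \<bar>x\<bar>} (\<lambda>x. \<bar>x\<bar> * \<bar>lcdf \<mu> x - lcdf \<gamma> x\<bar>)"
    by (simp add: set_integrable_def)
  have "ennreal (integral\<^sup>L lborel ?f) \<le> ennreal (2 * ?I \<mu> + 2 * ?I \<gamma>)"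
    using le nn_integral_eq_integral[OF int] by simp
  then show "cdf_gap \<mu> \<gamma> a \<le> 2 * ?I \<mu> + 2 * ?I \<gamma>"
    unfolding cdf_gap_def set_lebesgue_integral_def by (subst (asm) ennreal_le_iff) auto
  show "0 \<le> cdf_gap \<mu> \<gamma> a"
    unfolding cdf_gap_def set_lebesgue_integral_def by (intro integral_nonneg_AE) auto
qed

text \<open>
  The difference of indicators is \<open>1\<close> on \<open>(0, y]\<close> if \<open>y \<ge> 0\<close> and \<open>-1\<close> on \<open>(y, 0]\<close> otherwise, so this is
  the fundamental theorem of calculus in a form that is uniform in the sign of \<open>y\<close>.
\<close>

lemma integral_signed_step:
  fixes h :: "real \<Rightarrow> complex"
  assumes deriv: "\<And>x. (h has_vector_derivative h' x) (at x)" and cont: "continuous_on UNIV h'"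
  shows "(LINT x|lborel. (indicator {0<..} x - indicator {y<..} x :: real) *\<^sub>R h' x) = h y - h 0"
proof -
  have c: "continuous_on {a..b} h'" for a b using cont continuous_on_subset by blast
  have d: "(h has_vector_derivative h' x) (at x within {a..b})" for a b x
    using deriv has_vector_derivative_at_within by blast
  have [measurable]: "h' \<in> borel_measurable borel" using cont by (rule borel_measurable_continuous_onI)
  show ?thesis
  proof (cases "0 \<le> y")
    case True
    have "(LINT x|lborel. (indicator {0<..} x - indicator {y<..} x :: real) *\<^sub>R h' x)
        = (LINT x|lborel. indicator {0..y} x *\<^sub>R h' x)"
      by (rule integral_cong_AE, simp, simp)
         (use True AE_lborel_singleton[of 0] in \<open>auto elim!: eventually_mono split: split_indicator\<close>)
    also have "\<dots> = h y - h 0" by (rule integral_FTC_Icc[OF True d c])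
    finally show ?thesis .
  next
    case False
    have "(LINT x|lborel. (indicator {0<..} x - indicator {y<..} x :: real) *\<^sub>R h' x)
        = (LINT x|lborel. - (indicator {y..0} x *\<^sub>R h' x))"
      by (rule integral_cong_AE, simp, simp)
         (use False AE_lborel_singleton[of y] in \<open>auto elim!: eventually_mono split: split_indicator\<close>)
    also have "\<dots> = h y - h 0" using integral_FTC_Icc[of y 0 h h'] d c False by simp
    finally show ?thesis .
  qed
qed

text \<open>
  Integration by parts: integrate \<open>integral_signed_step\<close> over \<open>y\<close> and exchange the integrals. The
  subtracted indicator is what makes the integrand integrable; it cancels when two laws are
  compared.
\<close>

lemma expectation_via_lcdf:
  fixes h :: "real \<Rightarrow> complex"
  assumes m: "real_distribution \<mu>" "integrable \<mu> (\<lambda>y. y\<^sup>2)"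
    and deriv: "\<And>x. (h has_vector_derivative h' x) (at x)" and cont: "continuous_on UNIV h'"
    and bound: "\<And>x. norm (h' x) \<le> K * \<bar>x\<bar>" and h0: "h 0 = 0"
  shows "integrable lborel (\<lambda>x. (indicator {0<..} x - lcdf \<mu> x) *\<^sub>R h' x)"
    and "(LINT y|\<mu>. h y) = (LINT x|lborel. (indicator {0<..} x - lcdf \<mu> x) *\<^sub>R h' x)"
proof -
  interpret real_distribution \<mu> by fact
  interpret P: pair_sigma_finite \<mu> lborel
    by unfold_locales
  have [measurable]: "h' \<in> borel_measurable borel" using cont by (rule borel_measurable_continuous_onI)
  have K: "0 \<le> K" using order_trans[OF norm_ge_zero bound[of 1]] by simp
  \<comment> \<open>The indicators are written as conditionals so that joint measurability is found automatically.\<close>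
  let ?k = "\<lambda>y x. ((if 0 < x then 1 else 0) - (if y < x then 1 else 0) :: real) *\<^sub>R h' x"
  have [measurable]: "(\<lambda>(y, x). ?k y x) \<in> borel_measurable (\<mu> \<Otimes>\<^sub>M lborel)" by measurable
  have int: "integrable (\<mu> \<Otimes>\<^sub>M lborel) (\<lambda>(y, x). ?k y x)"
  proof (rule integrableI_bounded)
    have "(\<integral>\<^sup>+z. norm (case z of (y, x) \<Rightarrow> ?k y x) \<partial>(\<mu> \<Otimes>\<^sub>M lborel))
        = (\<integral>\<^sup>+y. \<integral>\<^sup>+x. norm (?k y x) \<partial>lborel \<partial>\<mu>)"
      by (subst lborel.nn_integral_fst[symmetric]) auto
    also have "\<dots> \<le> (\<integral>\<^sup>+y. ennreal K * ennreal (2 * (y\<^sup>2 * indicator {y. -1 < \<bar>y\<bar>} y)) \<partial>\<mu>)"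
    proof (rule nn_integral_mono)
      fix y
      have "norm (?k y x) \<le> K * (\<bar>x\<bar> * indicator {x. -1 < \<bar>x\<bar> \<and> \<bar>x\<bar> \<le> \<bar>y\<bar>} x)" for x
        using bound[of x] K by (auto split: split_indicator intro: mult_nonneg_nonpos)
      then have "(\<integral>\<^sup>+x. norm (?k y x) \<partial>lborel)
          \<le> (\<integral>\<^sup>+x. ennreal K * ennreal (\<bar>x\<bar> * indicator {x. -1 < \<bar>x\<bar> \<and> \<bar>x\<bar> \<le> \<bar>y\<bar>} x) \<partial>lborel)"
        using K by (intro nn_integral_mono) (simp only: ennreal_mult'[symmetric] ennreal_leI)
      also have "\<dots> = ennreal K * (\<integral>\<^sup>+x. ennreal (\<bar>x\<bar> * indicator {x. -1 < \<bar>x\<bar> \<and> \<bar>x\<bar> \<le> \<bar>y\<bar>} x) \<partial>lborel)"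
        by (rule nn_integral_cmult) auto
      also have "\<dots> \<le> ennreal K * ennreal (2 * (y\<^sup>2 * indicator {y. -1 < \<bar>y\<bar>} y))"
        by (intro mult_left_mono nn_integral_abs_band_le) auto
      finally show "(\<integral>\<^sup>+x. norm (?k y x) \<partial>lborel) \<le> ennreal K * ennreal (2 * (y\<^sup>2 * indicator {y. -1 < \<bar>y\<bar>} y))" .
    qed
    also have "\<dots> = (\<integral>\<^sup>+y. ennreal (K * (2 * y\<^sup>2)) \<partial>\<mu>)"
      using K by (intro nn_integral_cong) (auto simp: ennreal_mult)
    also have "\<dots> = ennreal (LINT y|\<mu>. K * (2 * y\<^sup>2))"
      using m(2) K by (intro nn_integral_eq_integral) auto
    also have "\<dots> < \<infinity>" by simp
    finally show "(\<integral>\<^sup>+z. norm (case z of (y, x) \<Rightarrow> ?k y x) \<partial>(\<mu> \<Otimes>\<^sub>M lborel)) < \<infinity>" .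
  qed simp
  have inner: "(LINT y|\<mu>. ?k y x) = (indicator {0<..} x - lcdf \<mu> x) *\<^sub>R h' x" for x
  proof -
    have [simp]: "integrable \<mu> (\<lambda>y. indicator {..<x} y :: real)"
      by (rule integrable_const_bound[of _ 1]) auto
    have "(LINT y|\<mu>. ?k y x) = (LINT y|\<mu>. (indicator {0<..} x - indicator {..<x} y) *\<^sub>R h' x)"
      by (rule Bochner_Integration.integral_cong) (auto split: split_indicator)
    also have "\<dots> = (LINT y|\<mu>. indicator {0<..} x - indicator {..<x} y) *\<^sub>R h' x"
      by (intro integral_scaleR_left) auto
    also have "(LINT y|\<mu>. indicator {0<..} x - indicator {..<x} y) = indicator {0<..} x - lcdf \<mu> x"
      using prob_space by (simp add: lcdf_def Bochner_Integration.integral_diff)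
    finally show ?thesis .
  qed
  have outer: "(LINT x|lborel. ?k y x) = h y" for y
    using integral_signed_step[OF deriv cont, of y] h0
    by (simp add: indicator_def of_bool_def greaterThan_iff)
  show "integrable lborel (\<lambda>x. (indicator {0<..} x - lcdf \<mu> x) *\<^sub>R h' x)"
    using P.integrable_snd[OF int] by (simp only: inner)
  show "(LINT y|\<mu>. h y) = (LINT x|lborel. (indicator {0<..} x - lcdf \<mu> x) *\<^sub>R h' x)"
    using P.Fubini_integral[OF int] by (simp only: inner outer)
qed

section \<open>Comparing characteristic functions through distribution functions\<close>

text \<open>
  The subtracted polynomial depends on the law only through its mean and variance, so that two
  centred laws of equal variance have the same correction terms.
\<close>

lemma expectation_char_remainder:
  assumes "real_distribution \<mu>" "integrable \<mu> (\<lambda>y. y\<^sup>2)"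
    and mean: "(LINT y|\<mu>. y) = 0"
  shows "(LINT y|\<mu>. iexp (u * y) - 1 - \<i> * of_real (u * y) + of_real ((u * y)\<^sup>2 / 2))
         = char \<mu> u - 1 + of_real (u\<^sup>2 / 2 * (LINT y|\<mu>. y\<^sup>2))"
proof -
  interpret real_distribution \<mu> by fact
  have i1: "integrable \<mu> (\<lambda>y. y)"
    using square_integrable_imp_integrable[of "\<lambda>y. y"] assms(2) by simp
  have i0: "integrable \<mu> (\<lambda>y. iexp (u * y))" by (rule integrable_const_bound[of _ 1]) auto
  have l: "(LINT y|\<mu>. \<i> * of_real (u * y)) = \<i> * complex_of_real (LINT y|\<mu>. u * y)"
    by (simp only: integral_mult_right_zero integral_complex_of_real)
  have q: "(LINT y|\<mu>. complex_of_real ((u * y)\<^sup>2 / 2)) = complex_of_real (u\<^sup>2 / 2 * (LINT y|\<mu>. y\<^sup>2))"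
    by (simp only: integral_complex_of_real) (simp add: power_mult_distrib)
  have il: "integrable \<mu> (\<lambda>y. \<i> * of_real (u * y))"
    by (intro integrable_mult_right integrable_of_real i1)
  have iq: "integrable \<mu> (\<lambda>y. complex_of_real ((u * y)\<^sup>2 / 2))"
    using assms(2) by (intro integrable_of_real) (simp add: power_mult_distrib)
  show ?thesis
    using i0 il iq prob_space mean
    by (simp only: Bochner_Integration.integral_add Bochner_Integration.integral_diff l q
        Bochner_Integration.integrable_add Bochner_Integration.integrable_diff integrable_const)
       (simp add: char_def)
qed

text \<open>
  The derivative of the Taylor remainder \<open>exp (i u x) - 1 - i u x + (u x)\<^sup>2 / 2\<close> is bounded by
  \<open>|u|\<^sup>3 x\<^sup>2 / 2\<close>, which is used where \<open>|x| \<le> a\<close>, and by \<open>2 u\<^sup>2 |x|\<close>, which is used on the tail. On the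
  central part one factor \<open>|x|\<close> is replaced by \<open>a\<close>, and what is left is the total gap, which is at
  most \<open>4 v\<close>.
\<close>

lemma char_diff_le_cdf_gap:
  assumes m: "real_distribution \<mu>" "integrable \<mu> (\<lambda>y. y\<^sup>2)" "(LINT y|\<mu>. y) = 0" "(LINT y|\<mu>. y\<^sup>2) = v"
    and g: "real_distribution \<gamma>" "integrable \<gamma> (\<lambda>y. y\<^sup>2)" "(LINT y|\<gamma>. y) = 0" "(LINT y|\<gamma>. y\<^sup>2) = v"
    and a: "0 \<le> a"
  shows "cmod (char \<mu> u - char \<gamma> u) \<le> 2 * \<bar>u\<bar>^3 * a * v + 2 * u\<^sup>2 * cdf_gap \<mu> \<gamma> a"
proof -
  define h where "h y = iexp (u * y) - 1 - \<i> * of_real (u * y) + of_real ((u * y)\<^sup>2 / 2)" for y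
  define h' where "h' y = \<i> * of_real u * (iexp (u * y) - 1 - \<i> * of_real (u * y))" for y
  have deriv: "(h has_vector_derivative h' x) (at x)" for x
  proof -
    have "((\<lambda>y. exp (\<i> * u * y) - 1 - \<i> * u * y + (u * y)\<^sup>2 / 2) has_field_derivative
           \<i> * of_real u * (exp (\<i> * u * complex_of_real x) - 1 - \<i> * u * complex_of_real x))
           (at (complex_of_real x))"
      by (auto intro!: derivative_eq_intros simp: power2_eq_square algebra_simps)
    from has_vector_derivative_real_field[OF this] show ?thesis
      unfolding h_def[abs_def] h'_def by (simp add: mult.assoc)
  qed
  have cont: "continuous_on UNIV h'" unfolding h'_def by (intro continuous_intros)
  have b1: "cmod (h' x) \<le> \<bar>u\<bar> * ((u * x)\<^sup>2 / 2)" for x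
    using mult_left_mono[OF iexp_approx1[of "u * x" 1], of "\<bar>u\<bar>"]
    by (simp add: h'_def norm_mult diff_diff_eq power2_eq_square)
  have b2: "cmod (h' x) \<le> 2 * u\<^sup>2 * \<bar>x\<bar>" for x
    using mult_left_mono[OF iexp_approx2[of "u * x" 1], of "\<bar>u\<bar>"]
    by (simp add: h'_def norm_mult diff_diff_eq abs_mult power2_eq_square mult_ac)
  have h0: "h 0 = 0" by (simp add: h_def)
  note em = expectation_via_lcdf[OF m(1,2) deriv cont b2 h0]
  note eg = expectation_via_lcdf[OF g(1,2) deriv cont b2 h0]
  let ?d = "\<lambda>x. \<bar>lcdf \<mu> x - lcdf \<gamma> x\<bar>"
  have all: "set_integrable lborel {x. -1 < \<bar>x\<bar>} (\<lambda>x. \<bar>x\<bar> * ?d x)"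
    and tail: "set_integrable lborel {x. a < \<bar>x\<bar>} (\<lambda>x. \<bar>x\<bar> * ?d x)"
    by (rule cdf_gap_bound(1)[OF m(1,2) g(1,2)])+
  have U: "{x::real. -1 < \<bar>x\<bar>} = UNIV" by (auto intro: less_le_trans[of _ 0])
  have int1: "integrable lborel (\<lambda>x. \<bar>x\<bar> * ?d x)"
    using all by (simp add: U set_integrable_def)
  have int2: "integrable lborel (\<lambda>x. indicator {x. a < \<bar>x\<bar>} x * (\<bar>x\<bar> * ?d x))"
    using tail by (simp add: set_integrable_def)
  have total: "(LINT x|lborel. \<bar>x\<bar> * ?d x) \<le> 4 * v"
    using cdf_gap_bound(2)[OF m(1,2) g(1,2), of "-1"] m(4) g(4)
    by (simp add: cdf_gap_def set_lebesgue_integral_def U)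
  have "char \<mu> u - char \<gamma> u = (LINT y|\<mu>. h y) - (LINT y|\<gamma>. h y)"
    using expectation_char_remainder[OF m(1-3), of u] expectation_char_remainder[OF g(1-3), of u] m(4) g(4)
    by (simp add: h_def)
  also have "\<dots> = (LINT x|lborel. (indicator {0<..} x - lcdf \<mu> x) *\<^sub>R h' x - (indicator {0<..} x - lcdf \<gamma> x) *\<^sub>R h' x)"
    by (subst Bochner_Integration.integral_diff[OF em(1) eg(1)]) (simp add: em(2) eg(2))
  also have "\<dots> = (LINT x|lborel. (lcdf \<gamma> x - lcdf \<mu> x) *\<^sub>R h' x)"
    by (simp add: scaleR_diff_left)
  finally have "cmod (char \<mu> u - char \<gamma> u) = cmod (LINT x|lborel. (lcdf \<gamma> x - lcdf \<mu> x) *\<^sub>R h' x)" by simp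
  also have "\<dots> \<le> (LINT x|lborel. \<bar>u\<bar>^3 * a / 2 * (\<bar>x\<bar> * ?d x)
                     + 2 * u\<^sup>2 * (indicator {x. a < \<bar>x\<bar>} x * (\<bar>x\<bar> * ?d x)))"
  proof (rule Bochner_Integration.integral_norm_bound_integral)
    show "integrable lborel (\<lambda>x. (lcdf \<gamma> x - lcdf \<mu> x) *\<^sub>R h' x)"
      using Bochner_Integration.integrable_diff[OF em(1) eg(1)] by (simp add: scaleR_diff_left)
    show "integrable lborel (\<lambda>x. \<bar>u\<bar>^3 * a / 2 * (\<bar>x\<bar> * ?d x)
                     + 2 * u\<^sup>2 * (indicator {x. a < \<bar>x\<bar>} x * (\<bar>x\<bar> * ?d x)))"
      by (intro Bochner_Integration.integrable_add integrable_mult_right int1 int2)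
    fix x :: real
    have d0: "0 \<le> ?d x" by simp
    show "norm ((lcdf \<gamma> x - lcdf \<mu> x) *\<^sub>R h' x) \<le> \<bar>u\<bar>^3 * a / 2 * (\<bar>x\<bar> * ?d x)
                     + 2 * u\<^sup>2 * (indicator {x. a < \<bar>x\<bar>} x * (\<bar>x\<bar> * ?d x))"
    proof (cases "a < \<bar>x\<bar>")
      case True
      have "?d x * cmod (h' x) \<le> ?d x * (2 * u\<^sup>2 * \<bar>x\<bar>)" by (intro mult_left_mono b2 d0)
      also have "\<dots> \<le> \<bar>u\<bar>^3 * a / 2 * (\<bar>x\<bar> * ?d x) + \<dots>" using a by simp
      finally show ?thesis using True by (simp add: abs_minus_commute mult_ac)
    next
      case False
      have "cmod (h' x) \<le> \<bar>u\<bar> * ((u * x)\<^sup>2 / 2)" by (rule b1)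
      also have "\<dots> = \<bar>u\<bar>^3 / 2 * (\<bar>x\<bar> * \<bar>x\<bar>)"
        by (simp add: power2_eq_square power3_eq_cube)
      also have "\<dots> \<le> \<bar>u\<bar>^3 / 2 * (a * \<bar>x\<bar>)"
        using False by (intro mult_left_mono mult_right_mono) auto
      finally have "?d x * cmod (h' x) \<le> ?d x * (\<bar>u\<bar>^3 / 2 * (a * \<bar>x\<bar>))" by (intro mult_left_mono d0)
      then show ?thesis using False by (simp add: abs_minus_commute mult_ac)
    qed
  qed
  also have "\<dots> = \<bar>u\<bar>^3 * a / 2 * (LINT x|lborel. \<bar>x\<bar> * ?d x) + 2 * u\<^sup>2 * cdf_gap \<mu> \<gamma> a"
    using int1 int2 by (simp add: cdf_gap_def set_lebesgue_integral_def)
  also have "\<dots> \<le> \<bar>u\<bar>^3 * a / 2 * (4 * v) + 2 * u\<^sup>2 * cdf_gap \<mu> \<gamma> a"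
    using a by (intro add_right_mono mult_left_mono total) auto
  finally show ?thesis by (simp add: algebra_simps)
qed

text \<open>
  Defined as an image of the standard normal law, which also covers the degenerate case \<open>s = 0\<close>.
\<close>

definition centred_normal :: "real \<Rightarrow> real measure" where
  "centred_normal s = distr std_normal_distribution borel (\<lambda>x. s * x)"

lemma real_distribution_centred_normal: "real_distribution (centred_normal s)"
proof -
  interpret real_distribution std_normal_distribution by (rule real_dist_normal_dist)
  show ?thesis unfolding centred_normal_def by (rule real_distribution_distr) simp
qed

lemma char_centred_normal: "char (centred_normal s) u = of_real (exp (- ((s * u)\<^sup>2 / 2)))"
proof -
  have "char (centred_normal s) u = char std_normal_distribution (s * u)"
    unfolding char_def centred_normal_def by (subst integral_distr) (auto simp: mult_ac)
  then show ?thesis by (simp add: char_std_normal_distribution)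
qed

lemma moments_centred_normal:
  "integrable (centred_normal s) (\<lambda>y. y\<^sup>2)" "(LINT y|centred_normal s. y) = 0"
  "(LINT y|centred_normal s. y\<^sup>2) = s\<^sup>2"
  "integrable (centred_normal s) (\<lambda>y. y^4)" "(LINT y|centred_normal s. y^4) = 3 * s^4"
  using std_normal_distribution_even_moments[of 1] std_normal_distribution_even_moments[of 2]
    integral_std_normal_distribution_moment_odd[of 1]
  unfolding centred_normal_def
  by (auto simp: integrable_distr_eq integral_distr power_mult_distrib fact_numeral)

text \<open>
  The normal law has no atoms, so the strict and the non-strict distribution function agree.
\<close>

lemma lcdf_centred_normal:
  assumes "0 < s"
  shows "lcdf (centred_normal s) x = Phi01 (x / s)"
proof -
  interpret real_distribution std_normal_distribution by (rule real_dist_normal_dist)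
  have "lcdf (centred_normal s) x = prob {..<x / s}"
    unfolding lcdf_def centred_normal_def using assms
    by (subst measure_distr) (auto simp: field_simps intro!: arg_cong[of _ _ prob])
  also have "\<dots> = prob {..x / s}"
    by (rule finite_measure_eq_AE)
       (auto simp: AE_density intro: AE_I2 eventually_mono[OF AE_lborel_singleton[of "x / s"]])
  finally show ?thesis by (simp add: Phi01_def cdf_def)
qed

section \<open>Taylor remainders of sine and cosine\<close>

lemma cos_ge_Taylor6: "1 - y\<^sup>2/2 + y^4/24 - y^6/720 \<le> cos (y::real)"
proof -
  obtain t where t: "cos y = (\<Sum>m<6. cos_coeff m * y ^ m) + cos (t + 1/2 * real 6 * pi) / fact 6 * y ^ 6"
    using Maclaurin_cos_expansion[of y 6] by blast
  have "cos (t + 1/2 * real 6 * pi) = - cos t"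
  proof -
    have "t + 1/2 * real 6 * pi = (t + pi) + 2 * pi" by simp
    then show ?thesis by (simp only: cos_periodic cos_periodic_pi)
  qed
  then have "- 1 \<le> cos (t + 1/2 * real 6 * pi)" by simp
  then have "- (y ^ 6) \<le> cos (t + 1/2 * real 6 * pi) * y ^ 6"
    using mult_right_mono[of "-1" "cos (t + 1/2 * real 6 * pi)" "y ^ 6"] by simp
  then have "- (y ^ 6) / 720 \<le> cos (t + 1/2 * real 6 * pi) / fact 6 * y ^ 6"
    by (simp add: fact_numeral)
  moreover have "(\<Sum>m<6. cos_coeff m * y ^ m) = 1 - y\<^sup>2/2 + y^4/24"
    by (simp add: cos_coeff_def lessThan_nat_numeral fact_numeral)
  ultimately show ?thesis using t by simp
qed

lemma sin_remainder_le_cube: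
  fixes y :: real
  shows "\<bar>sin y - y\<bar> \<le> \<bar>y\<bar>^3 / 6"
proof -
  have "\<bar>Im (iexp y - (\<Sum>k\<le>2. (\<i> * y)^k / fact k))\<bar> \<le> \<bar>y\<bar>^3 / 6"
    using order_trans[OF abs_Im_le_cmod iexp_approx1[of y 2]]
    by (simp add: fact_numeral numeral_3_eq_3)
  moreover have "Im (iexp y - (\<Sum>k\<le>2. (\<i> * y)^k / fact k)) = sin y - y"
    by (simp add: numeral_2_eq_2 Im_exp)
  ultimately show ?thesis by simp
qed

lemma cos_remainder_ge:
  fixes y :: real
  shows "min (y\<^sup>2) 9 * y\<^sup>2 / 40 \<le> cos y - 1 + y\<^sup>2 / 2"
proof (cases "y\<^sup>2 \<le> 9")
  case True
  have "y^6 = y^4 * y\<^sup>2" by (simp flip: power_add)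
  also have "\<dots> \<le> y^4 * 9" using True by (intro mult_left_mono) auto
  finally have "y^6 \<le> y^4 * 9" .
  moreover have "y\<^sup>2 * y\<^sup>2 = y^4" by (simp flip: power_add)
  moreover have "0 \<le> y^4" by simp
  ultimately have "y\<^sup>2 * y\<^sup>2 / 40 \<le> cos y - 1 + y\<^sup>2 / 2" using cos_ge_Taylor6[of y] by linarith
  then show ?thesis using True by (simp add: min_def)
next
  case False
  then have "9 * y\<^sup>2 / 40 \<le> cos y - 1 + y\<^sup>2 / 2" using cos_ge_minus_one[of y] by linarith
  then show ?thesis using False by (simp add: min_def)
qed

text \<open>
  Both sides are of order \<open>y\<^sup>6\<close> at the origin, with constants \<open>1/36\<close> and \<open>1/24\<close>; for \<open>|y| \<le> 3\<close> the
  Taylor bounds preserve this order, and for larger \<open>|y|\<close> the left side is at most \<open>16 y\<^sup>2 / 9\<close>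
  while the second factor on the right is at least \<open>5/2\<close>.
\<close>

lemma sin_remainder_sq_le:
  fixes y :: real
  shows "(sin y - y)\<^sup>2 \<le> y\<^sup>2 * (cos y - 1 + y\<^sup>2 / 2)"
proof (cases "y\<^sup>2 \<le> 9")
  case True
  have "(sin y - y)\<^sup>2 \<le> (\<bar>y\<bar>^3 / 6)\<^sup>2"
    using sin_remainder_le_cube[of y] by (metis abs_ge_zero power2_abs power_mono)
  also have "\<dots> = y\<^sup>2 * (y^4 / 36)"
    by (simp add: power_divide flip: power_mult power_add)
  also have "\<dots> \<le> y\<^sup>2 * (cos y - 1 + y\<^sup>2 / 2)"
  proof (rule mult_left_mono)
    have "y^6 = y^4 * y\<^sup>2" by (simp flip: power_add)
    also have "\<dots> \<le> y^4 * 9" using True by (intro mult_left_mono) auto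
    finally have "y^6 \<le> y^4 * 9" .
    moreover have "0 \<le> y^4" by simp
    ultimately show "y^4 / 36 \<le> cos y - 1 + y\<^sup>2 / 2" using cos_ge_Taylor6[of y] by linarith
  qed simp
  finally show ?thesis .
next
  case False
  then have y3: "3 \<le> \<bar>y\<bar>" using abs_le_square_iff[of 3 y] by simp
  have "\<bar>sin y - y\<bar> \<le> 4 / 3 * \<bar>y\<bar>" using y3 sin_le_one[of y] sin_ge_minus_one[of y] by linarith
  then have "\<bar>sin y - y\<bar>\<^sup>2 \<le> (4 / 3 * \<bar>y\<bar>)\<^sup>2" by (intro power_mono) auto
  then have "(sin y - y)\<^sup>2 \<le> y\<^sup>2 * (16 / 9)" by (simp add: power_mult_distrib power_divide)
  also have "\<dots> \<le> y\<^sup>2 * (cos y - 1 + y\<^sup>2 / 2)"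
  proof (rule mult_left_mono)
    show "16 / 9 \<le> cos y - 1 + y\<^sup>2 / 2" using False cos_ge_minus_one[of y] by linarith
  qed simp
  finally show ?thesis .
qed

text \<open>
  A linearised form of \<open>sin_remainder_sq_le\<close>, by the inequality of arithmetic and geometric means.
  It can be integrated and summed term by term, and optimising over \<open>l\<close> afterwards yields
  Cauchy-Schwarz for the whole sum.
\<close>

lemma sin_remainder_le:
  fixes y l :: real
  assumes "0 < l"
  shows "\<bar>sin y - y\<bar> \<le> (l * y\<^sup>2 + (cos y - 1 + y\<^sup>2 / 2) / l) / 2"
proof -
  let ?q = "cos y - 1 + y\<^sup>2 / 2"
  have q: "0 \<le> ?q" using order_trans[OF _ cos_remainder_ge[of y]] by simp
  have "\<bar>2 * (sin y - y)\<bar> \<le> l * y\<^sup>2 + ?q / l"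
  proof (rule abs_le_square_iff[THEN iffD2, THEN order_trans])
    have "(2 * (sin y - y))\<^sup>2 = 4 * (sin y - y)\<^sup>2" by (simp only: power_mult_distrib) simp
    also have "\<dots> \<le> 4 * ((l * y\<^sup>2) * (?q / l))"
      using sin_remainder_sq_le[of y] assms by simp
    also have "\<dots> \<le> (l * y\<^sup>2 + ?q / l)\<^sup>2"
    proof -
      have "4 * (a * b) \<le> (a + b)\<^sup>2" for a b :: real
        using zero_le_power2[of "a - b"] by (simp add: power2_sum power2_diff)
      then show ?thesis .
    qed
    finally show "(2 * (sin y - y))\<^sup>2 \<le> (l * y\<^sup>2 + ?q / l)\<^sup>2" .
    show "\<bar>l * y\<^sup>2 + ?q / l\<bar> \<le> l * y\<^sup>2 + ?q / l" using q assms by simp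
  qed
  then have le: "2 * \<bar>sin y - y\<bar> \<le> l * y\<^sup>2 + ?q / l" by (simp only: abs_mult abs_numeral)
  have "d \<le> w / 2" if "2 * d \<le> w" for d w :: real using that by simp
  from this[OF le] show ?thesis .
qed

section \<open>The excess of a characteristic function over its Gaussian part\<close>

text \<open>
  The amount by which \<open>Re (f(u) - 1)\<close> exceeds its second order Taylor polynomial \<open>- u\<^sup>2 v / 2\<close>,
  where \<open>f\<close> is the characteristic function and \<open>v\<close> the variance of a centred law.
\<close>

definition gauss_excess :: "real measure \<Rightarrow> real \<Rightarrow> real" where
  "gauss_excess \<mu> u = (LINT y|\<mu>. cos (u * y) - 1 + (u * y)\<^sup>2 / 2)"

text \<open>
  Pointwise Taylor bounds, integrated. The last item says that the excess
  controls the truncated variance of Lindeberg's condition.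
\<close>

lemma char_minus_one:
  assumes m: "real_distribution \<mu>" "integrable \<mu> (\<lambda>y. y\<^sup>2)" "(LINT y|\<mu>. y) = 0" "(LINT y|\<mu>. y\<^sup>2) = v"
  shows "Re (char \<mu> u - 1) = gauss_excess \<mu> u - u\<^sup>2 * v / 2"
    and "Im (char \<mu> u - 1) = (LINT y|\<mu>. sin (u * y) - u * y)"
    and "0 \<le> gauss_excess \<mu> u" and "gauss_excess \<mu> u \<le> u\<^sup>2 * v / 2"
    and "0 < l \<Longrightarrow> \<bar>Im (char \<mu> u - 1)\<bar> \<le> (l * (u\<^sup>2 * v) + gauss_excess \<mu> u / l) / 2"
    and "cmod (char \<mu> u - 1) \<le> u\<^sup>2 * v / 2"
    and "0 < \<epsilon> \<Longrightarrow> u\<^sup>2 * (LINT y|\<mu>. y\<^sup>2 * indicator {y. \<epsilon> < \<bar>u * y\<bar>} y) \<le> 40 / min (\<epsilon>\<^sup>2) 9 * gauss_excess \<mu> u"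
proof -
  interpret real_distribution \<mu> by fact
  have i1: "integrable \<mu> (\<lambda>y. y)"
    using square_integrable_imp_integrable[of "\<lambda>y. y"] m(2) by simp
  have i1': "integrable \<mu> (\<lambda>y. u * y)" using i1 by simp
  have i2: "integrable \<mu> (\<lambda>y. (u * y)\<^sup>2 / 2)" using m(2) by (simp add: power_mult_distrib)
  have i2': "integrable \<mu> (\<lambda>y. (u * y)\<^sup>2)" using m(2) by (simp add: power_mult_distrib)
  have ie: "integrable \<mu> (\<lambda>y. iexp (u * y))" by (rule integrable_const_bound[of _ 1]) auto
  have ic: "integrable \<mu> (\<lambda>y. cos (u * y))" by (rule integrable_const_bound[of _ 1]) auto
  have isn: "integrable \<mu> (\<lambda>y. sin (u * y))" by (rule integrable_const_bound[of _ 1]) auto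
  have iq: "integrable \<mu> (\<lambda>y. cos (u * y) - 1 + (u * y)\<^sup>2 / 2)" using ic i2 by simp
  have ir: "integrable \<mu> (\<lambda>y. sin (u * y) - u * y)" using isn i1' by simp
  have sq: "(LINT y|\<mu>. (u * y)\<^sup>2 / 2) = u\<^sup>2 * v / 2" using m(4) by (simp add: power_mult_distrib)
  have re: "Re (char \<mu> u) = (LINT y|\<mu>. cos (u * y))"
    unfolding char_def using integral_Re[OF ie] by (simp add: Re_exp)
  have im: "Im (char \<mu> u) = (LINT y|\<mu>. sin (u * y))"
    unfolding char_def using integral_Im[OF ie] by (simp add: Im_exp)
  have ge: "gauss_excess \<mu> u = Re (char \<mu> u) - 1 + u\<^sup>2 * v / 2"
    unfolding gauss_excess_def re sq[symmetric] using ic i2 prob_space by simp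
  show "Re (char \<mu> u - 1) = gauss_excess \<mu> u - u\<^sup>2 * v / 2" using ge by simp
  show I: "Im (char \<mu> u - 1) = (LINT y|\<mu>. sin (u * y) - u * y)"
    using im isn i1' m(3) by simp
  show "0 \<le> gauss_excess \<mu> u"
    unfolding gauss_excess_def
    by (intro integral_nonneg_AE AE_I2 order_trans[OF _ cos_remainder_ge]) auto
  have "gauss_excess \<mu> u \<le> (LINT y|\<mu>. (u * y)\<^sup>2 / 2)"
    unfolding gauss_excess_def by (intro integral_mono iq i2) simp
  then show "gauss_excess \<mu> u \<le> u\<^sup>2 * v / 2" using sq by simp
  show "\<bar>Im (char \<mu> u - 1)\<bar> \<le> (l * (u\<^sup>2 * v) + gauss_excess \<mu> u / l) / 2" if l: "0 < l"
  proof -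
    have "\<bar>Im (char \<mu> u - 1)\<bar> \<le> (LINT y|\<mu>. (l * (u * y)\<^sup>2 + (cos (u * y) - 1 + (u * y)\<^sup>2 / 2) / l) / 2)"
      unfolding I real_norm_def[symmetric]
    proof (rule Bochner_Integration.integral_norm_bound_integral[OF ir])
      show "integrable \<mu> (\<lambda>y. (l * (u * y)\<^sup>2 + (cos (u * y) - 1 + (u * y)\<^sup>2 / 2) / l) / 2)"
        by (intro integrable_divide Bochner_Integration.integrable_add integrable_mult_right i2' iq)
      show "norm (sin (u * y) - u * y) \<le> (l * (u * y)\<^sup>2 + (cos (u * y) - 1 + (u * y)\<^sup>2 / 2) / l) / 2" for y
        unfolding real_norm_def by (rule sin_remainder_le[OF l])
    qed
    also have "\<dots> = (LINT y|\<mu>. l * ((u * y)\<^sup>2 / 2) + (cos (u * y) - 1 + (u * y)\<^sup>2 / 2) / (2 * l))"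
      by (simp add: add_divide_distrib mult.commute)
    also have "\<dots> = l * (LINT y|\<mu>. (u * y)\<^sup>2 / 2) + gauss_excess \<mu> u / (2 * l)"
      unfolding gauss_excess_def
      by (subst Bochner_Integration.integral_add)
         (simp_all only: integral_mult_right_zero integral_divide_zero integrable_mult_right integrable_divide i2 iq)
    finally show ?thesis unfolding sq by (simp add: add_divide_distrib)
  qed
  have "cmod (LINT y|\<mu>. iexp (u * y) - 1 - \<i> * of_real (u * y)) \<le> (LINT y|\<mu>. (u * y)\<^sup>2 / 2)"
  proof (rule Bochner_Integration.integral_norm_bound_integral)
    show "integrable \<mu> (\<lambda>y. iexp (u * y) - 1 - \<i> * of_real (u * y))"
      by (intro Bochner_Integration.integrable_diff ie integrable_mult_right integrable_of_real i1') auto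
    show "norm (iexp (u * y) - 1 - \<i> * of_real (u * y)) \<le> (u * y)\<^sup>2 / 2" for y
      using iexp_approx1[of "u * y" 1] by (simp add: diff_diff_eq power2_eq_square)
  qed (rule i2)
  also have "(LINT y|\<mu>. iexp (u * y) - 1 - \<i> * of_real (u * y)) = char \<mu> u - 1"
  proof -
    have l: "(LINT y|\<mu>. \<i> * of_real (u * y)) = \<i> * complex_of_real (LINT y|\<mu>. u * y)"
      by (simp only: integral_mult_right_zero integral_complex_of_real)
    have il: "integrable \<mu> (\<lambda>y. \<i> * of_real (u * y))"
      by (intro integrable_mult_right integrable_of_real i1')
    show ?thesis
      using ie il prob_space m(3)
      by (simp only: Bochner_Integration.integral_diff l Bochner_Integration.integrable_diff integrable_const)
         (simp add: char_def)
  qed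
  finally show "cmod (char \<mu> u - 1) \<le> u\<^sup>2 * v / 2" unfolding sq .
  show "u\<^sup>2 * (LINT y|\<mu>. y\<^sup>2 * indicator {y. \<epsilon> < \<bar>u * y\<bar>} y) \<le> 40 / min (\<epsilon>\<^sup>2) 9 * gauss_excess \<mu> u"
    if e: "0 < \<epsilon>"
  proof -
    let ?c = "min (\<epsilon>\<^sup>2) 9"
    have c: "0 < ?c" using e by simp
    have "u\<^sup>2 * (LINT y|\<mu>. y\<^sup>2 * indicator {y. \<epsilon> < \<bar>u * y\<bar>} y)
        = (LINT y|\<mu>. (u * y)\<^sup>2 * indicator {y. \<epsilon> < \<bar>u * y\<bar>} y)"
      by (simp add: power_mult_distrib mult.assoc)
    also have "\<dots> \<le> (LINT y|\<mu>. 40 / ?c * (cos (u * y) - 1 + (u * y)\<^sup>2 / 2))"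
    proof (rule integral_mono)
      show "integrable \<mu> (\<lambda>y. (u * y)\<^sup>2 * indicator {y. \<epsilon> < \<bar>u * y\<bar>} y)"
        by (rule Bochner_Integration.integrable_bound[of _ "\<lambda>y. (u * y)\<^sup>2"])
           (use i2' in \<open>auto split: split_indicator\<close>)
      show "integrable \<mu> (\<lambda>y. 40 / ?c * (cos (u * y) - 1 + (u * y)\<^sup>2 / 2))"
        by (rule integrable_mult_right) (rule iq)
      fix y
      let ?q = "cos (u * y) - 1 + (u * y)\<^sup>2 / 2"
      show "(u * y)\<^sup>2 * indicator {y. \<epsilon> < \<bar>u * y\<bar>} y \<le> 40 / ?c * ?q"
      proof (cases "\<epsilon> < \<bar>u * y\<bar>")
        case True
        then have "\<epsilon>\<^sup>2 \<le> (u * y)\<^sup>2" using e abs_le_square_iff[of \<epsilon> "u * y"] by simp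
        then have "?c * (u * y)\<^sup>2 \<le> min ((u * y)\<^sup>2) 9 * (u * y)\<^sup>2"
          by (intro mult_right_mono) auto
        also have "\<dots> \<le> 40 * ?q" using cos_remainder_ge[of "u * y"] by simp
        finally show ?thesis using True c by (simp add: pos_le_divide_eq mult_ac)
      next
        case False
        have "0 \<le> ?q" using order_trans[OF _ cos_remainder_ge[of "u * y"]] by simp
        then show ?thesis using False c by simp
      qed
    qed
    also have "\<dots> = 40 / ?c * gauss_excess \<mu> u"
      unfolding gauss_excess_def by (rule integral_mult_right_zero)
    finally show ?thesis .
  qed
qed

lemma cos_ge_one_minus_half_square: "1 - x\<^sup>2 / 2 \<le> cos (x::real)"
  using order_trans[OF _ cos_remainder_ge[of x], of 0] by simp

text \<open>
  The one-sided deviation on which necessity rests. In the product each factor \<open>f\<^sub>j\<close> is replaced by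
  \<open>exp (f\<^sub>j - 1)\<close>, at the cost \<open>2 |f\<^sub>j - 1|\<^sup>2\<close>, and the costs add up to at most \<open>r / 2\<close>. The resulting
  exponent has real part \<open>D - 1/2\<close> and imaginary part \<open>I\<close> with \<open>I\<^sup>2 \<le> D \<le> 1/2\<close>, so that
  \<open>exp D cos I \<ge> (1 + D) (1 - D / 2) \<ge> 1 + D / 4\<close>.
\<close>

lemma Re_prod_char_ge:
  fixes \<mu> :: "'i \<Rightarrow> real measure"
  assumes fin: "finite J"
    and m: "\<And>j. j \<in> J \<Longrightarrow> real_distribution (\<mu> j)" "\<And>j. j \<in> J \<Longrightarrow> integrable (\<mu> j) (\<lambda>y. y\<^sup>2)"
      "\<And>j. j \<in> J \<Longrightarrow> (LINT y|\<mu> j. y) = 0" "\<And>j. j \<in> J \<Longrightarrow> (LINT y|\<mu> j. y\<^sup>2) = v j"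
    and total: "(\<Sum>j\<in>J. u\<^sup>2 * v j) = 1"
    and le: "\<And>j. j \<in> J \<Longrightarrow> u\<^sup>2 * v j \<le> r"
  shows "exp (-1/2) * (1 + (\<Sum>j\<in>J. gauss_excess (\<mu> j) u) / 4) - r / 2 \<le> Re (\<Prod>j\<in>J. char (\<mu> j) u)"
proof -
  define z where "z j = char (\<mu> j) u - 1" for j
  define D where "D = (\<Sum>j\<in>J. gauss_excess (\<mu> j) u)"
  define I where "I = (\<Sum>j\<in>J. Im (z j))"
  note c = char_minus_one[OF m]
  have v0: "0 \<le> u\<^sup>2 * v j" if "j \<in> J" for j using c(3,4)[OF that that that that, of u] by linarith
  have v1: "u\<^sup>2 * v j \<le> 1" if "j \<in> J" for j
    using member_le_sum[OF that, of "\<lambda>j. u\<^sup>2 * v j"] v0 fin total by simp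
  have Re_z: "(\<Sum>j\<in>J. Re (z j)) = D - 1 / 2"
  proof -
    have "(\<Sum>j\<in>J. Re (z j)) = (\<Sum>j\<in>J. gauss_excess (\<mu> j) u - u\<^sup>2 * v j / 2)"
      unfolding z_def by (intro sum.cong refl c(1))
    then show ?thesis using total by (simp add: D_def sum_subtractf flip: sum_divide_distrib)
  qed
  have D0: "0 \<le> D" unfolding D_def by (intro sum_nonneg c(3))
  have "D \<le> (\<Sum>j\<in>J. u\<^sup>2 * v j / 2)" unfolding D_def by (intro sum_mono c(4))
  then have D1: "D \<le> 1 / 2" using total by (simp flip: sum_divide_distrib)
  have I_le: "\<bar>I\<bar> \<le> (l + D / l) / 2" if l: "0 < l" for l
  proof -
    have "\<bar>I\<bar> \<le> (\<Sum>j\<in>J. \<bar>Im (z j)\<bar>)" unfolding I_def by (rule sum_abs)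
    also have "\<dots> \<le> (\<Sum>j\<in>J. (l * (u\<^sup>2 * v j) + gauss_excess (\<mu> j) u / l) / 2)"
      unfolding z_def by (intro sum_mono c(5) l)
    also have "\<dots> = (l * (\<Sum>j\<in>J. u\<^sup>2 * v j) + D / l) / 2"
      unfolding D_def by (simp only: sum_divide_distrib[symmetric] sum.distrib sum_distrib_left)
    finally show ?thesis using total by simp
  qed
  \<comment> \<open>The optimal choice is \<open>l = sqrt D\<close>; if \<open>D\<close> vanishes, \<open>l\<close> has to tend to \<open>0\<close> instead.\<close>
  have I_sq: "I\<^sup>2 \<le> D"
  proof (cases "D = 0")
    case True
    have "\<bar>I\<bar> \<le> 0 + e" if "0 < e" for e using I_le[of "2 * e"] that True by simp
    then have "\<bar>I\<bar> \<le> 0" by (rule field_le_epsilon)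
    then show ?thesis using True by simp
  next
    case False
    then have "\<bar>I\<bar> \<le> sqrt D" using I_le[of "sqrt D"] D0 by (simp add: real_div_sqrt)
    then have "\<bar>I\<bar>\<^sup>2 \<le> (sqrt D)\<^sup>2" by (intro power_mono) auto
    then show ?thesis using D0 by simp
  qed
  have "exp (-1/2) * (1 + D / 4) \<le> exp (-1/2) * ((1 + D) * (1 - D / 2))"
  proof (intro mult_left_mono)
    have "D * D \<le> D * (1/2)" using D0 D1 by (intro mult_left_mono)
    moreover have "(1 + D) * (1 - D / 2) = 1 + D / 2 - D * D / 2" by (simp add: algebra_simps add_divide_distrib)
    ultimately show "1 + D / 4 \<le> (1 + D) * (1 - D / 2)" by linarith
  qed simp
  also have "\<dots> \<le> exp (-1/2) * (exp D * cos I)"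
  proof (intro mult_left_mono mult_mono)
    show "1 + D \<le> exp D" by (rule exp_ge_add_one_self)
    show "1 - D / 2 \<le> cos I" using cos_ge_one_minus_half_square[of I] I_sq by simp
  qed (use D1 in auto)
  also have "\<dots> = Re (exp (\<Sum>j\<in>J. z j))"
  proof -
    have "Re (exp (\<Sum>j\<in>J. z j)) = exp (D - 1 / 2) * cos I"
      using Re_z by (simp add: Re_exp I_def)
    also have "exp (D - 1 / 2) = exp (-1/2) * exp D" by (simp flip: exp_add)
    finally show ?thesis by simp
  qed
  finally have main: "exp (-1/2) * (1 + D / 4) \<le> Re (exp (\<Sum>j\<in>J. z j))" .
  have "cmod ((\<Prod>j\<in>J. char (\<mu> j) u) - (\<Prod>j\<in>J. exp (z j))) \<le> (\<Sum>j\<in>J. cmod (char (\<mu> j) u - exp (z j)))"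
  proof (rule norm_prod_diff)
    fix j assume j: "j \<in> J"
    interpret real_distribution "\<mu> j" by (rule m(1)[OF j])
    show "cmod (char (\<mu> j) u) \<le> 1" by (rule cmod_char_le_1)
    have "Re (char (\<mu> j) u) \<le> 1" using complex_Re_le_cmod cmod_char_le_1 order_trans by blast
    then show "cmod (exp (z j)) \<le> 1" by (simp add: z_def)
  qed
  also have "\<dots> \<le> (\<Sum>j\<in>J. r / 2 * (u\<^sup>2 * v j))"
  proof (rule sum_mono)
    fix j assume j: "j \<in> J"
    have z1: "cmod (z j) \<le> u\<^sup>2 * v j / 2" unfolding z_def by (rule c(6)[OF j j j j])
    then have "\<bar>Re (z j)\<bar> \<le> 1 / 2"
      using abs_Re_le_cmod[of "z j"] v1[OF j] by linarith
    then have e: "exp \<bar>Re (z j)\<bar> \<le> 2"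
      using exp_bound_half[of "\<bar>Re (z j)\<bar>"] by simp
    have "cmod (char (\<mu> j) u - exp (z j)) = cmod (exp (z j) - (\<Sum>k\<le>1. z j ^ k / fact k))"
      by (simp add: z_def norm_minus_commute)
    also have "\<dots> \<le> exp \<bar>Re (z j)\<bar> * cmod (z j) ^ 2"
      using Taylor_exp[of "z j" 1] by (simp add: power2_eq_square)
    also have "\<dots> \<le> 2 * (u\<^sup>2 * v j / 2)\<^sup>2"
      using e z1 by (intro mult_mono power_mono) auto
    also have "\<dots> = (u\<^sup>2 * v j) * (u\<^sup>2 * v j) / 2" by (simp add: power2_eq_square)
    also have "\<dots> \<le> r * (u\<^sup>2 * v j) / 2"
      using le[OF j] v0[OF j] by (intro divide_right_mono mult_right_mono) auto
    finally show "cmod (char (\<mu> j) u - exp (z j)) \<le> r / 2 * (u\<^sup>2 * v j)" by simp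
  qed
  also have "\<dots> = r / 2 * (\<Sum>j\<in>J. u\<^sup>2 * v j)" by (rule sum_distrib_left[symmetric])
  also have "\<dots> = r / 2" using total by simp
  finally have "cmod ((\<Prod>j\<in>J. char (\<mu> j) u) - exp (\<Sum>j\<in>J. z j)) \<le> r / 2"
    using fin by (simp add: exp_sum)
  then have "\<bar>Re ((\<Prod>j\<in>J. char (\<mu> j) u) - exp (\<Sum>j\<in>J. z j))\<bar> \<le> r / 2"
    using abs_Re_le_cmod order_trans by blast
  then have "Re (exp (\<Sum>j\<in>J. z j)) - r / 2 \<le> Re (\<Prod>j\<in>J. char (\<mu> j) u)"
    by (simp only: minus_complex.sel abs_le_iff) linarith
  then show ?thesis using main unfolding D_def by linarith
qed

section \<open>Rotar sums and products of characteristic functions\<close>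

text \<open>
  The normal law of variance \<open>b\<^sup>2\<close> is factorised into normal laws with the variances of the summands,
  and the two products are compared factor by factor.
\<close>

lemma prod_char_diff_le:
  fixes \<mu> :: "'i \<Rightarrow> real measure"
  assumes m: "\<And>j. j \<in> J \<Longrightarrow> real_distribution (\<mu> j)" "\<And>j. j \<in> J \<Longrightarrow> integrable (\<mu> j) (\<lambda>y. y\<^sup>2)"
      "\<And>j. j \<in> J \<Longrightarrow> (LINT y|\<mu> j. y) = 0" "\<And>j. j \<in> J \<Longrightarrow> (LINT y|\<mu> j. y\<^sup>2) = (s j)\<^sup>2"
    and fin: "finite J" and b: "0 < b" and total: "(\<Sum>j\<in>J. (s j)\<^sup>2) = b\<^sup>2" and \<epsilon>: "0 < \<epsilon>"
  shows "cmod ((\<Prod>j\<in>J. char (\<mu> j) (t / b)) - exp (- (t\<^sup>2 / 2)))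
         \<le> 2 * \<bar>t\<bar>^3 * \<epsilon> + 2 * t\<^sup>2 * (1 / b\<^sup>2 * (\<Sum>j\<in>J. cdf_gap (\<mu> j) (centred_normal (s j)) (\<epsilon> * b)))"
proof -
  let ?W = "\<lambda>j. cdf_gap (\<mu> j) (centred_normal (s j)) (\<epsilon> * b)"
  have "(\<Prod>j\<in>J. char (centred_normal (s j)) (t / b)) = of_real (\<Prod>j\<in>J. exp (- ((s j * (t / b))\<^sup>2 / 2)))"
    by (simp add: char_centred_normal)
  also have "(\<Prod>j\<in>J. exp (- ((s j * (t / b))\<^sup>2 / 2))) = exp (\<Sum>j\<in>J. - ((s j * (t / b))\<^sup>2 / 2))"
    using fin by (simp add: exp_sum)
  also have "(\<Sum>j\<in>J. - ((s j * (t / b))\<^sup>2 / 2)) = - (t\<^sup>2 / 2)"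
    using total b by (simp add: sum_negf power_mult_distrib power_divide flip: sum_divide_distrib sum_distrib_right)
  finally have normal: "(\<Prod>j\<in>J. char (centred_normal (s j)) (t / b)) = exp (- (t\<^sup>2 / 2))"
    by (simp add: exp_of_real)
  have "cmod ((\<Prod>j\<in>J. char (\<mu> j) (t / b)) - (\<Prod>j\<in>J. char (centred_normal (s j)) (t / b)))
      \<le> (\<Sum>j\<in>J. cmod (char (\<mu> j) (t / b) - char (centred_normal (s j)) (t / b)))"
    by (rule norm_prod_diff)
       (auto intro!: real_distribution.cmod_char_le_1 m real_distribution_centred_normal)
  also have "\<dots> \<le> (\<Sum>j\<in>J. 2 * \<bar>t / b\<bar>^3 * (\<epsilon> * b) * (s j)\<^sup>2 + 2 * (t / b)\<^sup>2 * ?W j)"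
    using b \<epsilon>
    by (intro sum_mono char_diff_le_cdf_gap m real_distribution_centred_normal moments_centred_normal) auto
  also have "\<dots> = 2 * \<bar>t / b\<bar>^3 * (\<epsilon> * b) * b\<^sup>2 + 2 * (t / b)\<^sup>2 * (\<Sum>j\<in>J. ?W j)"
    using total by (simp add: sum.distrib flip: sum_distrib_left)
  also have "2 * \<bar>t / b\<bar>^3 * (\<epsilon> * b) * b\<^sup>2 = 2 * \<bar>t\<bar>^3 * \<epsilon>"
    using b by (simp add: power_divide power2_eq_square power3_eq_cube)
  also have "2 * (t / b)\<^sup>2 * (\<Sum>j\<in>J. ?W j) = 2 * t\<^sup>2 * (1 / b\<^sup>2 * (\<Sum>j\<in>J. ?W j))"
    by (simp add: power_divide)
  finally show ?thesis by (simp add: normal)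
qed

text \<open>
  The gap is bounded by truncated second moments. Those of the summands are controlled by the
  excess \<open>D\<close>, hence by the real part of the product; those of the matching normal laws are controlled
  by fourth moments, which under the Feller bound \<open>r\<close> are small relative to the variances.
\<close>

lemma sum_cdf_gap_le:
  fixes \<mu> :: "'i \<Rightarrow> real measure"
  assumes m: "\<And>j. j \<in> J \<Longrightarrow> real_distribution (\<mu> j)" "\<And>j. j \<in> J \<Longrightarrow> integrable (\<mu> j) (\<lambda>y. y\<^sup>2)"
      "\<And>j. j \<in> J \<Longrightarrow> (LINT y|\<mu> j. y) = 0" "\<And>j. j \<in> J \<Longrightarrow> (LINT y|\<mu> j. y\<^sup>2) = (s j)\<^sup>2"
    and fin: "finite J" and b: "0 < b" and total: "(\<Sum>j\<in>J. (s j)\<^sup>2) = b\<^sup>2" and \<epsilon>: "0 < \<epsilon>"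
    and r: "\<And>j. j \<in> J \<Longrightarrow> 1 / b\<^sup>2 * (s j)\<^sup>2 \<le> r"
  defines "c \<equiv> 40 / min (\<epsilon>\<^sup>2) 9"
  shows "1 / b\<^sup>2 * (\<Sum>j\<in>J. cdf_gap (\<mu> j) (centred_normal (s j)) (\<epsilon> * b))
         \<le> 8 * c * (exp (1/2) * Re (\<Prod>j\<in>J. char (\<mu> j) (1 / b)) - 1) + (4 * c * exp (1/2) + 6 / \<epsilon>\<^sup>2) * r"
proof -
  define D where "D = (\<Sum>j\<in>J. gauss_excess (\<mu> j) (1 / b))"
  let ?W = "\<lambda>j. cdf_gap (\<mu> j) (centred_normal (s j)) (\<epsilon> * b)"
  let ?L = "\<lambda>\<nu>. LINT y|\<nu>. y\<^sup>2 * indicator {y. \<epsilon> * b < \<bar>y\<bar>} y"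
  have c0: "0 < c" using \<epsilon> by (simp add: c_def)
  have set: "{y. \<epsilon> < \<bar>1 / b * y\<bar>} = {y. \<epsilon> * b < \<bar>y\<bar>}"
    using b by (auto simp: abs_mult field_simps)
  have lind: "1 / b\<^sup>2 * ?L (\<mu> j) \<le> c * gauss_excess (\<mu> j) (1 / b)" if j: "j \<in> J" for j
    using char_minus_one(7)[OF m(1-4)[OF j] \<epsilon>, of "1 / b"] unfolding set c_def by (simp add: power_divide)
  have normal: "1 / b\<^sup>2 * ?L (centred_normal (s j)) \<le> 3 / \<epsilon>\<^sup>2 * r * (1 / b\<^sup>2 * (s j)\<^sup>2)" if j: "j \<in> J" for j
  proof -
    have "?L (centred_normal (s j)) \<le> (LINT y|centred_normal (s j). 1 / (\<epsilon> * b)\<^sup>2 * y^4)"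
    proof (rule integral_mono)
      interpret real_distribution "centred_normal (s j)" by (rule real_distribution_centred_normal)
      show "integrable (centred_normal (s j)) (\<lambda>y. y\<^sup>2 * indicator {y. \<epsilon> * b < \<bar>y\<bar>} y)"
        by (rule Bochner_Integration.integrable_bound[OF moments_centred_normal(1)])
           (auto split: split_indicator)
      show "integrable (centred_normal (s j)) (\<lambda>y. 1 / (\<epsilon> * b)\<^sup>2 * y^4)"
        by (intro integrable_mult_right moments_centred_normal)
      fix y
      show "y\<^sup>2 * indicator {y. \<epsilon> * b < \<bar>y\<bar>} y \<le> 1 / (\<epsilon> * b)\<^sup>2 * y^4"
      proof (cases "\<epsilon> * b < \<bar>y\<bar>")
        case True
        then have "(\<epsilon> * b)\<^sup>2 \<le> y\<^sup>2" using \<epsilon> b abs_le_square_iff[of "\<epsilon> * b" y] by simp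
        then have "y\<^sup>2 * (\<epsilon> * b)\<^sup>2 \<le> y\<^sup>2 * y\<^sup>2" by (intro mult_left_mono) auto
        also have "\<dots> = y^4" by (simp flip: power_add)
        finally have "y\<^sup>2 * (\<epsilon> * b)\<^sup>2 \<le> y^4" .
        moreover have "0 < (\<epsilon> * b)\<^sup>2" using \<epsilon> b by simp
        ultimately show ?thesis using True by (simp add: pos_le_divide_eq)
      qed simp
    qed
    also have "\<dots> = 1 / (\<epsilon> * b)\<^sup>2 * (3 * (s j)^4)"
      by (simp only: integral_mult_right_zero moments_centred_normal)
    finally have "1 / b\<^sup>2 * ?L (centred_normal (s j)) \<le> 1 / b\<^sup>2 * (1 / (\<epsilon> * b)\<^sup>2 * (3 * (s j)^4))"
      by (intro mult_left_mono) auto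
    also have "\<dots> = 3 / \<epsilon>\<^sup>2 * (1 / b\<^sup>2 * (s j)\<^sup>2) * (1 / b\<^sup>2 * (s j)\<^sup>2)"
      by (simp add: power_mult_distrib field_simps power2_eq_square power4_eq_xxxx)
    also have "\<dots> \<le> 3 / \<epsilon>\<^sup>2 * r * (1 / b\<^sup>2 * (s j)\<^sup>2)"
      by (intro mult_right_mono mult_left_mono r j) auto
    finally show ?thesis .
  qed
  have tot: "(\<Sum>j\<in>J. 1 / b\<^sup>2 * (s j)\<^sup>2) = 1"
    using total b by (simp flip: sum_divide_distrib)
  have "1 / b\<^sup>2 * (\<Sum>j\<in>J. ?W j) = (\<Sum>j\<in>J. 1 / b\<^sup>2 * ?W j)" by (rule sum_distrib_left)
  also have "\<dots> \<le> (\<Sum>j\<in>J. 2 * (c * gauss_excess (\<mu> j) (1 / b)) + 2 * (3 / \<epsilon>\<^sup>2 * r * (1 / b\<^sup>2 * (s j)\<^sup>2)))"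
  proof (rule sum_mono)
    fix j assume j: "j \<in> J"
    have "1 / b\<^sup>2 * ?W j \<le> 1 / b\<^sup>2 * (2 * ?L (\<mu> j) + 2 * ?L (centred_normal (s j)))"
      by (intro mult_left_mono cdf_gap_bound m j real_distribution_centred_normal moments_centred_normal) auto
    also have "\<dots> = 2 * (1 / b\<^sup>2 * ?L (\<mu> j)) + 2 * (1 / b\<^sup>2 * ?L (centred_normal (s j)))"
      by (simp only: distrib_left mult.left_commute)
    also have "\<dots> \<le> 2 * (c * gauss_excess (\<mu> j) (1 / b)) + 2 * (3 / \<epsilon>\<^sup>2 * r * (1 / b\<^sup>2 * (s j)\<^sup>2))"
      by (intro add_mono mult_left_mono lind normal j) auto
    finally show "1 / b\<^sup>2 * ?W j \<le> 2 * (c * gauss_excess (\<mu> j) (1 / b)) + 2 * (3 / \<epsilon>\<^sup>2 * r * (1 / b\<^sup>2 * (s j)\<^sup>2))" .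
  qed
  also have "\<dots> = 2 * (c * D) + 2 * (3 / \<epsilon>\<^sup>2 * r * (\<Sum>j\<in>J. 1 / b\<^sup>2 * (s j)\<^sup>2))"
    unfolding D_def by (simp only: sum.distrib sum_distrib_left)
  also have "\<dots> = 2 * c * D + 6 / \<epsilon>\<^sup>2 * r" unfolding tot by simp
  finally have W: "1 / b\<^sup>2 * (\<Sum>j\<in>J. ?W j) \<le> 2 * c * D + 6 / \<epsilon>\<^sup>2 * r" .
  let ?R = "Re (\<Prod>j\<in>J. char (\<mu> j) (1 / b))"
  have "exp (-1/2) * (1 + D / 4) - r / 2 \<le> ?R"
    unfolding D_def
    by (rule Re_prod_char_ge[OF fin m]) (use tot r in \<open>simp_all add: power_divide\<close>)
  then have "exp (1/2) * (exp (-1/2) * (1 + D / 4) - r / 2) \<le> exp (1/2) * ?R"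
    by (intro mult_left_mono) auto
  moreover have "exp (1/2) * exp (-1/2 :: real) = 1" by (simp flip: exp_add)
  then have "exp (1/2) * (exp (-1/2) * (1 + D / 4) - r / 2) = 1 + D / 4 - exp (1/2) * r / 2"
    by (simp only: right_diff_distrib mult.assoc[symmetric]) simp
  ultimately have "1 + D / 4 - exp (1/2) * r / 2 \<le> exp (1/2) * ?R" by (simp only:)
  moreover have "d \<le> 4 * (x - 1) + 2 * w" if "1 + d / 4 - w / 2 \<le> x" for d w x :: real
    using that by (simp add: field_simps)
  ultimately have "D \<le> 4 * (exp (1/2) * ?R - 1) + 2 * (exp (1/2) * r)" by blast
  then have "D \<le> 4 * (exp (1/2) * ?R - 1) + 2 * exp (1/2) * r" by (simp only: mult.assoc)
  then have "2 * c * D \<le> 2 * c * (4 * (exp (1/2) * ?R - 1) + 2 * exp (1/2) * r)"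
    using c0 by (intro mult_left_mono) auto
  also have "\<dots> = 8 * c * (exp (1/2) * ?R - 1) + 4 * c * exp (1/2) * r" by (simp add: algebra_simps)
  finally show ?thesis using W by (simp add: distrib_right)
qed

section \<open>Kolmogorov distance to the normal law\<close>

text \<open>
  Moves a uniform bound between the left-continuous and the right-continuous distribution function
  of the same law.
\<close>

lemma sandwich_closeness:
  fixes G H \<Psi> :: "real \<Rightarrow> real"
  assumes close: "\<And>x. \<bar>G x - \<Psi> x\<bar> \<le> \<eta>" and cont: "\<And>x. isCont \<Psi> x"
    and sandwich: "\<And>x d. 0 < d \<Longrightarrow> G (x - d) \<le> H x" "\<And>x d. 0 < d \<Longrightarrow> H x \<le> G (x + d)"
  shows "\<bar>H x - \<Psi> x\<bar> \<le> \<eta>"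
proof (rule field_le_epsilon)
  fix e :: real assume e: "0 < e"
  obtain d where d: "0 < d" "\<And>y. dist y x < d \<Longrightarrow> dist (\<Psi> y) (\<Psi> x) < e"
    using cont[of x] e unfolding continuous_at_eps_delta by blast
  have "\<bar>\<Psi> (x - d / 2) - \<Psi> x\<bar> < e" "\<bar>\<Psi> (x + d / 2) - \<Psi> x\<bar> < e"
    using d(2)[of "x - d / 2"] d(2)[of "x + d / 2"] d(1) by (simp_all add: dist_real_def)
  moreover have "G (x - d / 2) \<le> H x" "H x \<le> G (x + d / 2)"
    using sandwich[of "d / 2"] d(1) by auto
  ultimately show "\<bar>H x - \<Psi> x\<bar> \<le> \<eta> + e"
    using close[of "x - d / 2"] close[of "x + d / 2"] by linarith
qed

text \<open>
  Polya's theorem: pointwise convergence of distribution functions to a continuous one is uniform.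
  The grid consists of points where the limit takes the values \<open>i / m\<close>. Monotonicity then traps every
  \<open>x\<close> between two grid points, of which the lower one is taken one step further down because \<open>\<Psi>\<close> may be
  constant near \<open>x\<close>.
\<close>

lemma polya_uniform:
  fixes G :: "nat \<Rightarrow> real \<Rightarrow> real" and \<Psi> :: "real \<Rightarrow> real"
  assumes mono_G: "\<And>n. mono (G n)" and G01: "\<And>n x. 0 \<le> G n x" "\<And>n x. G n x \<le> 1"
    and mono_P: "mono \<Psi>" and P01: "\<And>x. 0 \<le> \<Psi> x" "\<And>x. \<Psi> x \<le> 1"
    and cont: "\<And>x. isCont \<Psi> x" and lim: "(\<Psi> \<longlongrightarrow> 0) at_bot" "(\<Psi> \<longlongrightarrow> 1) at_top"
    and conv: "\<And>x. (\<lambda>n. G n x) \<longlonglongrightarrow> \<Psi> x" and \<eta>: "0 < \<eta>"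
  shows "\<forall>\<^sub>F n in sequentially. \<forall>x. \<bar>G n x - \<Psi> x\<bar> \<le> \<eta>"
proof -
  obtain m :: nat where m: "3 / \<eta> < m" using reals_Archimedean2 by blast
  have m0: "0 < m" using m \<eta> by (cases m) (auto simp: divide_less_0_iff)
  have m3: "3 / m < \<eta>" using m \<eta> m0 by (simp add: field_simps)
  have ivt: "\<exists>x. \<Psi> x = p" if p: "0 < p" "p < 1" for p
  proof -
    obtain a where a: "\<Psi> a < p"
      using order_tendstoD(2)[OF lim(1) p(1)] unfolding eventually_at_bot_linorder by auto
    obtain b where b: "p < \<Psi> b"
      using order_tendstoD(1)[OF lim(2) p(2)] unfolding eventually_at_top_linorder by auto
    have "a \<le> b" using a b monoD[OF mono_P, of b a] by force
    then show ?thesis using IVT[of \<Psi> a p b] a b cont by force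
  qed
  have "\<exists>x. \<Psi> x = real i / m" if "i \<in> {1..<m}" for i using that m0 by (intro ivt) auto
  then obtain q where q: "\<And>i. i \<in> {1..<m} \<Longrightarrow> \<Psi> (q i) = real i / m" by metis
  have "\<forall>\<^sub>F n in sequentially. \<forall>i\<in>{1..<m}. \<bar>G n (q i) - \<Psi> (q i)\<bar> < 1 / m"
    using tendstoD[OF conv, of "1 / m"] m0
    by (intro eventually_ball_finite) (auto simp: dist_real_def)
  then show ?thesis
  proof (rule eventually_mono)
    fix n assume grid: "\<forall>i\<in>{1..<m}. \<bar>G n (q i) - \<Psi> (q i)\<bar> < 1 / m"
    show "\<forall>x. \<bar>G n x - \<Psi> x\<bar> \<le> \<eta>"
    proof
      fix x
      define i where "i = nat \<lfloor>m * \<Psi> x\<rfloor>"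
      have fl: "real i \<le> m * \<Psi> x" "m * \<Psi> x < real i + 1"
        using P01(1)[of x] m0 unfolding i_def by (auto simp: of_nat_nat)
      have lo: "real i / m \<le> \<Psi> x" and up: "\<Psi> x < (real i + 1) / m"
        using fl m0 by (auto simp: field_simps)
      have "G n x \<le> \<Psi> x + 3 / m"
      proof (cases "i + 1 < m")
        case True
        then have q': "\<Psi> (q (i + 1)) = (real i + 1) / m" using q[of "i + 1"] by simp
        then have "x \<le> q (i + 1)" using up monoD[OF mono_P, of "q (i + 1)" x] by force
        then have "G n x \<le> G n (q (i + 1))" by (rule monoD[OF mono_G])
        also have "\<dots> \<le> (real i + 1) / m + 1 / m" using grid[rule_format, of "i + 1"] True q' by simp
        also have "\<dots> = real i / m + 2 / m" by (simp flip: add_divide_distrib)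
        also have "\<dots> \<le> \<Psi> x + 3 / m" using lo by (intro add_mono divide_right_mono) auto
        finally show ?thesis .
      next
        case False
        then have "real m \<le> real i + 1" by simp
        then have "1 \<le> (real i + 1) / m" using m0 by simp
        then have "1 \<le> real i / m + 1 / m" by (simp only: add_divide_distrib)
        moreover have "1 / real m \<le> 3 / m" by (rule divide_right_mono) auto
        ultimately show ?thesis using lo G01(2)[of n x] by linarith
      qed
      moreover have "\<Psi> x - 3 / m \<le> G n x"
      proof (cases "1 < i")
        case True
        have "real i \<le> real m" using fl(1) mult_left_mono[OF P01(2)[of x], of "real m"] by simp
        then have i: "i - 1 \<in> {1..<m}" using True by auto
        then have q': "\<Psi> (q (i - 1)) = (real i - 1) / m" using q True by (simp add: of_nat_diff)
        moreover have "(real i - 1) / m < real i / m" using m0 by (simp add: divide_strict_right_mono)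
        ultimately have "q (i - 1) \<le> x" using lo monoD[OF mono_P, of x "q (i - 1)"] by force
        then have "G n (q (i - 1)) \<le> G n x" by (rule monoD[OF mono_G])
        moreover have "(real i - 1) / m - 1 / m \<le> G n (q (i - 1))" using grid[rule_format, OF i] q' by linarith
        ultimately have "(real i - 1) / m - 1 / m \<le> G n x" by linarith
        then show ?thesis using up by (simp add: add_divide_distrib diff_divide_distrib)
      next
        case False
        then have "(real i + 1) / m \<le> 3 / m" by (intro divide_right_mono) auto
        then show ?thesis using up G01(1)[of n x] by linarith
      qed
      ultimately show "\<bar>G n x - \<Psi> x\<bar> \<le> \<eta>" using m3 by linarith
    qed
  qed
qed

lemma Phi01_properties:
  "mono Phi01" "0 \<le> Phi01 x" "Phi01 x \<le> 1" "isCont Phi01 x"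
  "(Phi01 \<longlongrightarrow> 0) at_bot" "(Phi01 \<longlongrightarrow> 1) at_top"
proof -
  interpret real_distribution std_normal_distribution by (rule real_dist_normal_dist)
  have eq: "Phi01 = cdf std_normal_distribution" by (auto simp: Phi01_def)
  show "mono Phi01" unfolding eq mono_def using cdf_nondecreasing by blast
  show "0 \<le> Phi01 x" "Phi01 x \<le> 1" unfolding eq by (rule cdf_nonneg cdf_bounded_prob)+
  show "(Phi01 \<longlongrightarrow> 0) at_bot" "(Phi01 \<longlongrightarrow> 1) at_top"
    unfolding eq by (rule cdf_lim_at_bot cdf_lim_at_top_prob)+
  have "emeasure std_normal_distribution {x}
      = (\<integral>\<^sup>+y. ennreal (std_normal_density y) * indicator {x} y \<partial>lborel)"
    by (rule emeasure_density) auto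
  also have "\<dots> = integral\<^sup>N (lborel :: real measure) (\<lambda>y. 0)"
  proof (rule nn_integral_cong_AE)
    show "AE y in lborel. ennreal (std_normal_density y) * indicator {x} y = 0"
      using AE_lborel_singleton[of x] by eventually_elim auto
  qed
  finally have "emeasure std_normal_distribution {x} = 0" by simp
  then show "isCont Phi01 x" unfolding eq isCont_cdf by (simp add: measure_def)
qed

definition kolmogorov_dist :: "real measure \<Rightarrow> real" where
  "kolmogorov_dist P = (SUP x. \<bar>lcdf P x - Phi01 x\<bar>)"

lemma lcdf_cdf_sandwich:
  assumes "real_distribution P" "0 < d"
  shows "lcdf P (x - d) \<le> cdf P x" "cdf P x \<le> lcdf P (x + d)"
    "cdf P (x - d) \<le> lcdf P x" "lcdf P x \<le> cdf P (x + d)"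
proof -
  interpret real_distribution P by fact
  show "lcdf P (x - d) \<le> cdf P x" "cdf P x \<le> lcdf P (x + d)"
    "cdf P (x - d) \<le> lcdf P x" "lcdf P x \<le> cdf P (x + d)"
    unfolding lcdf_def cdf_def using assms(2) by (auto intro!: finite_measure_mono)
qed

lemma abs_lcdf_minus_Phi01_le:
  assumes "real_distribution P"
  shows "\<bar>lcdf P x - Phi01 x\<bar> \<le> 1"
proof -
  interpret real_distribution P by fact
  have "0 \<le> lcdf P x" "lcdf P x \<le> 1" by (auto simp: lcdf_def)
  then show ?thesis using Phi01_properties(2,3)[of x] by linarith
qed

lemma abs_lcdf_minus_Phi01_le_kolmogorov_dist:
  assumes "real_distribution P"
  shows "\<bar>lcdf P x - Phi01 x\<bar> \<le> kolmogorov_dist P"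
  unfolding kolmogorov_dist_def
  by (rule cSUP_upper) (auto intro!: bdd_aboveI2 abs_lcdf_minus_Phi01_le[OF assms])

text \<open>
  The continuity theorem is about pointwise convergence of right-continuous distribution functions.
  Polya's theorem makes that convergence uniform, and the limit having no atoms, it does not matter
  which of the two kinds of distribution function is used.
\<close>

theorem kolmogorov_dist_tendsto_0_iff:
  assumes P: "\<And>n. real_distribution (P n)"
  shows "(\<lambda>n. kolmogorov_dist (P n)) \<longlonglongrightarrow> 0 \<longleftrightarrow>
         (\<forall>t. (\<lambda>n. char (P n) t) \<longlonglongrightarrow> exp (- (t\<^sup>2 / 2)))"
proof -
  have nonneg: "0 \<le> kolmogorov_dist (P n)" for n
    using abs_lcdf_minus_Phi01_le_kolmogorov_dist[OF P, of n 0] by linarith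
  have target: "char std_normal_distribution t = exp (- (t\<^sup>2 / 2))" for t
    by (simp add: char_std_normal_distribution exp_of_real)
  have Phi_cdf: "Phi01 = cdf std_normal_distribution" by (auto simp: Phi01_def)
  show ?thesis
  proof
    assume K: "(\<lambda>n. kolmogorov_dist (P n)) \<longlonglongrightarrow> 0"
    have "weak_conv_m P std_normal_distribution"
      unfolding weak_conv_m_def weak_conv_def
    proof (intro allI impI)
      fix x
      have "\<bar>cdf (P n) x - Phi01 x\<bar> \<le> kolmogorov_dist (P n)" for n
        by (rule sandwich_closeness[OF abs_lcdf_minus_Phi01_le_kolmogorov_dist[OF P]
              Phi01_properties(4) lcdf_cdf_sandwich(1,2)[OF P]])
      then have "(\<lambda>n. cdf (P n) x - Phi01 x) \<longlonglongrightarrow> 0"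
        by (intro Lim_null_comparison[OF _ K]) auto
      then show "(\<lambda>n. cdf (P n) x) \<longlonglongrightarrow> cdf std_normal_distribution x"
        unfolding Phi_cdf by (rule LIM_zero_cancel)
    qed
    from levy_continuity1[OF P real_dist_normal_dist this]
    show "\<forall>t. (\<lambda>n. char (P n) t) \<longlonglongrightarrow> exp (- (t\<^sup>2 / 2))" unfolding target by blast
  next
    assume C: "\<forall>t. (\<lambda>n. char (P n) t) \<longlonglongrightarrow> exp (- (t\<^sup>2 / 2))"
    have "weak_conv_m P std_normal_distribution"
      by (rule levy_continuity[OF P real_dist_normal_dist]) (use C target in auto)
    then have conv: "(\<lambda>n. cdf (P n) x) \<longlonglongrightarrow> Phi01 x" for x
      using Phi01_properties(4)[of x] unfolding weak_conv_m_def weak_conv_def Phi_cdf by simp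
    have mono_cdf: "mono (cdf (P n))" and cdf01: "0 \<le> cdf (P n) x" "cdf (P n) x \<le> 1" for n x
    proof -
      interpret real_distribution "P n" by (rule P)
      show "mono (cdf (P n))" unfolding mono_def using cdf_nondecreasing by blast
      show "0 \<le> cdf (P n) x" "cdf (P n) x \<le> 1" by (rule cdf_nonneg cdf_bounded_prob)+
    qed
    show "(\<lambda>n. kolmogorov_dist (P n)) \<longlonglongrightarrow> 0"
    proof (rule tendstoI)
      fix e :: real assume e: "0 < e"
      have "\<forall>\<^sub>F n in sequentially. \<forall>x. \<bar>cdf (P n) x - Phi01 x\<bar> \<le> e / 2"
        by (rule polya_uniform[OF mono_cdf cdf01 Phi01_properties conv]) (use e in simp)
      then show "\<forall>\<^sub>F n in sequentially. dist (kolmogorov_dist (P n)) 0 < e"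
      proof (rule eventually_mono)
        fix n assume close: "\<forall>x. \<bar>cdf (P n) x - Phi01 x\<bar> \<le> e / 2"
        have "\<bar>lcdf (P n) x - Phi01 x\<bar> \<le> e / 2" for x
          by (rule sandwich_closeness[OF close[rule_format] Phi01_properties(4)
                lcdf_cdf_sandwich(3,4)[OF P]])
        then have "kolmogorov_dist (P n) \<le> e / 2"
          unfolding kolmogorov_dist_def by (intro cSUP_least) auto
        then show "dist (kolmogorov_dist (P n)) 0 < e"
          using nonneg[of n] e by (simp add: dist_real_def)
      qed
    qed
  qed
qed

section \<open>Sums with a random number of terms\<close>

lemma (in prob_space) sum_over_index:
  fixes f :: "'a \<Rightarrow> 'b::{banach, second_countable_topology}"
  assumes N[measurable]: "N \<in> measurable M (count_space UNIV)" and pos: "\<And>\<omega>. \<omega> \<in> space M \<Longrightarrow> 1 \<le> N \<omega>"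
    and f: "integrable M f"
  shows "(LINT \<omega>|M. f \<omega>) = (\<Sum>k. LINT \<omega>:{\<omega> \<in> space M. N \<omega> = Suc k}|M. f \<omega>)"
proof -
  have U: "(\<Union>k. {\<omega> \<in> space M. N \<omega> = Suc k}) = space M"
    using pos by (auto simp: Suc_le_eq gr0_conv_Suc)
  have si: "set_integrable M (space M) f" 
  proof -
    have "integrable M (\<lambda>\<omega>. indicator (space M) \<omega> *\<^sub>R f \<omega>) = integrable M f"
      by (rule Bochner_Integration.integrable_cong) auto
    then show ?thesis unfolding set_integrable_def using f by simp
  qed
  have "(LINT \<omega>|M. f \<omega>) = (LINT \<omega>:(\<Union>k. {\<omega> \<in> space M. N \<omega> = Suc k})|M. f \<omega>)"
    unfolding U using set_integral_space[OF f] by simp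
  also have "\<dots> = (\<Sum>k. LINT \<omega>:{\<omega> \<in> space M. N \<omega> = Suc k}|M. f \<omega>)"
    by (rule lebesgue_integral_countable_add) (use si U in auto)
  finally show ?thesis .
qed

lemma (in prob_space) integrable_index:
  fixes g :: "nat \<Rightarrow> 'b::{banach, second_countable_topology}"
  assumes N[measurable]: "N \<in> measurable M (count_space UNIV)" and pos: "\<And>\<omega>. \<omega> \<in> space M \<Longrightarrow> 1 \<le> N \<omega>"
    and g: "\<And>k. 1 \<le> k \<Longrightarrow> norm (g k) \<le> C"
  shows "integrable M (\<lambda>\<omega>. g (N \<omega>))"
  by (rule integrable_const_bound[of _ C]) (use g pos in auto)

text \<open>
  With a bounded integrand the series over the values of the index is an expectation, which gives
  monotonicity and linearity of \<^const>\<open>expect_at\<close> without further summability arguments.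
\<close>

lemma (in prob_space) expectation_index:
  fixes g :: "nat \<Rightarrow> 'b::{banach, second_countable_topology}"
  assumes N[measurable]: "N \<in> measurable M (count_space UNIV)" and pos: "\<And>\<omega>. \<omega> \<in> space M \<Longrightarrow> 1 \<le> N \<omega>"
    and g: "\<And>k. 1 \<le> k \<Longrightarrow> norm (g k) \<le> C"
  shows "(LINT \<omega>|M. g (N \<omega>)) = (\<Sum>k. prob {\<omega> \<in> space M. N \<omega> = Suc k} *\<^sub>R g (Suc k))"
proof -
  have "(LINT \<omega>:{\<omega> \<in> space M. N \<omega> = Suc k}|M. g (N \<omega>)) = prob {\<omega> \<in> space M. N \<omega> = Suc k} *\<^sub>R g (Suc k)" for k
  proof -
    have "(LINT \<omega>:{\<omega> \<in> space M. N \<omega> = Suc k}|M. g (N \<omega>)) = (LINT \<omega>:{\<omega> \<in> space M. N \<omega> = Suc k}|M. g (Suc k))"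
      by (rule set_lebesgue_integral_cong) auto
    then show ?thesis by (simp add: set_integral_const emeasure_eq_measure)
  qed
  moreover have "integrable M (\<lambda>\<omega>. g (N \<omega>))" by (rule integrable_index[OF N pos g])
  ultimately show ?thesis using sum_over_index[OF N pos, of "\<lambda>\<omega>. g (N \<omega>)"] by simp
qed

lemma (in prob_space) expect_at_eq_expectation:
  assumes "N \<in> measurable M (count_space UNIV)" "\<And>\<omega>. \<omega> \<in> space M \<Longrightarrow> 1 \<le> N \<omega>"
    and "\<And>k. 1 \<le> k \<Longrightarrow> \<bar>g k\<bar> \<le> C"
  shows "expect_at M N g = expectation (\<lambda>\<omega>. g (N \<omega>))"
  using expectation_index[of N g C] assms by (simp add: expect_at_def)

lemma borel_measurable_random_sum:
  assumes X: "\<And>j. 1 \<le> j \<Longrightarrow> X j \<in> borel_measurable M" and N: "N \<in> measurable M (count_space UNIV)"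
  shows "(\<lambda>\<omega>. S X (N \<omega>) \<omega> / B M X (N \<omega>)) \<in> borel_measurable M"
proof (rule measurable_compose_countable[of "\<lambda>k \<omega>. S X k \<omega> / B M X k", OF _ N])
  show "(\<lambda>\<omega>. S X k \<omega> / B M X k) \<in> borel_measurable M" for k
    unfolding S_def by (intro borel_measurable_divide borel_measurable_sum X) auto
qed

text \<open>
  On each event \<open>{N = k}\<close> the index is independent of the sum of the first \<open>k\<close> terms, and the
  characteristic function of that sum is a product.
\<close>

lemma (in prob_space) char_random_sum:
  assumes X: "\<And>j. 1 \<le> j \<Longrightarrow> X j \<in> borel_measurable M"
    and N[measurable]: "N \<in> measurable M (count_space UNIV)" and pos: "\<And>\<omega>. \<omega> \<in> space M \<Longrightarrow> 1 \<le> N \<omega>"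
    and indep: "indep_with_index M N X"
  shows "char (distr M borel (\<lambda>\<omega>. S X (N \<omega>) \<omega> / B M X (N \<omega>))) t
         = (LINT \<omega>|M. (\<Prod>j=1..N \<omega>. char (distr M borel (X j)) (t / B M X (N \<omega>))))"
proof -
  define Y where "Y = (\<lambda>\<omega>. S X (N \<omega>) \<omega> / B M X (N \<omega>))"
  have [measurable]: "Y \<in> borel_measurable M" unfolding Y_def by (rule borel_measurable_random_sum[OF X N])
  define Z where "Z = (\<lambda>j. if j = 0 then (\<lambda>\<omega>. real (N \<omega>)) else X j)"
  have Z: "indep_vars (\<lambda>_. borel) Z UNIV" using indep unfolding indep_with_index_def Z_def .
  define \<phi> where "\<phi> k = (\<Prod>j=1..k. char (distr M borel (X j)) (t / B M X k))" for k
  have \<phi>: "norm (\<phi> k) \<le> 1" for k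
  proof -
    have "norm (\<phi> k) = (\<Prod>j=1..k. cmod (char (distr M borel (X j)) (t / B M X k)))"
      unfolding \<phi>_def by (rule prod_norm[symmetric])
    also have "\<dots> \<le> 1"
      by (intro prod_le_1) (auto intro!: real_distribution.cmod_char_le_1 real_distribution_distr X)
    finally show ?thesis .
  qed
  have int: "integrable M (\<lambda>\<omega>. iexp (t * Y \<omega>))" by (rule integrable_const_bound[of _ 1]) auto
  \<comment> \<open>The event is encoded by an indicator of \<open>real (N \<omega>)\<close>, since the independent family carries the index as a real variable.\<close>
  have slice: "(LINT \<omega>:{\<omega> \<in> space M. N \<omega> = Suc k}|M. iexp (t * Y \<omega>))
      = prob {\<omega> \<in> space M. N \<omega> = Suc k} *\<^sub>R \<phi> (Suc k)" for k
  proof -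
    have meas_S[measurable]: "S X (Suc k) \<in> borel_measurable M"
      unfolding S_def[abs_def] by (intro borel_measurable_sum X) auto
    let ?u = "t / B M X (Suc k)"
    have "indep_var borel (Z 0) borel (\<lambda>\<omega>. \<Sum>i\<in>{1..Suc k}. Z i \<omega>)"
      by (rule indep_vars_sum) (auto intro: indep_vars_subset[OF Z])
    moreover have "(\<lambda>\<omega>. \<Sum>i\<in>{1..Suc k}. Z i \<omega>) = S X (Suc k)"
      unfolding S_def[abs_def] Z_def by (intro ext sum.cong) auto
    ultimately have "indep_var borel (\<lambda>\<omega>. real (N \<omega>)) borel (S X (Suc k))" by (simp add: Z_def)
    from indep_var_compose[OF this, of "\<lambda>x. indicator {real (Suc k)} x :: complex" borel "\<lambda>x. iexp (?u * x)" borel]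
    have ind: "indep_var borel (\<lambda>\<omega>. indicator {real (Suc k)} (real (N \<omega>)) :: complex) borel (\<lambda>\<omega>. iexp (?u * S X (Suc k) \<omega>))"
      by (simp add: comp_def)
    have "(LINT \<omega>:{\<omega> \<in> space M. N \<omega> = Suc k}|M. iexp (t * Y \<omega>))
        = (LINT \<omega>|M. indicator {real (Suc k)} (real (N \<omega>)) * iexp (?u * S X (Suc k) \<omega>))"
      unfolding set_lebesgue_integral_def
      by (rule Bochner_Integration.integral_cong) (auto simp: Y_def simp del: of_nat_Suc split: split_indicator)
    also have "\<dots> = (LINT \<omega>|M. indicator {real (Suc k)} (real (N \<omega>))) * (LINT \<omega>|M. iexp (?u * S X (Suc k) \<omega>))"
      by (rule indep_var_lebesgue_integral[OF ind]; rule integrable_const_bound[of _ 1])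
         (auto split: split_indicator)
    also have "(LINT \<omega>|M. indicator {real (Suc k)} (real (N \<omega>)) :: complex)
        = of_real (prob {\<omega> \<in> space M. N \<omega> = Suc k})"
    proof -
      have "(LINT \<omega>|M. indicator {real (Suc k)} (real (N \<omega>)) :: complex)
          = (LINT \<omega>|M. complex_of_real (indicator {\<omega> \<in> space M. N \<omega> = Suc k} \<omega>))"
        by (rule Bochner_Integration.integral_cong) (auto split: split_indicator)
      also have "\<dots> = of_real (LINT \<omega>|M. indicator {\<omega> \<in> space M. N \<omega> = Suc k} \<omega>)"
        by (rule integral_complex_of_real)
      finally show ?thesis by simp
    qed
    also have "(LINT \<omega>|M. iexp (?u * S X (Suc k) \<omega>)) = char (distr M borel (S X (Suc k))) ?u"
      unfolding char_def by (subst integral_distr) auto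
    also have "\<dots> = (\<Prod>i\<in>{1..Suc k}. char (distr M borel (Z i)) ?u)"
    proof -
      have "S X (Suc k) = (\<lambda>\<omega>. \<Sum>i\<in>{1..Suc k}. Z i \<omega>)"
        unfolding S_def[abs_def] Z_def by (intro ext sum.cong) auto
      then show ?thesis using char_distr_sum[OF indep_vars_subset[OF Z subset_UNIV], of "{1..Suc k}" ?u] by simp
    qed
    also have "\<dots> = \<phi> (Suc k)" unfolding \<phi>_def Z_def by (rule prod.cong) auto
    finally show ?thesis by (simp add: scaleR_conv_of_real)
  qed
  have "char (distr M borel Y) t = (LINT \<omega>|M. iexp (t * Y \<omega>))"
    unfolding char_def by (subst integral_distr) auto
  also have "\<dots> = (\<Sum>k. prob {\<omega> \<in> space M. N \<omega> = Suc k} *\<^sub>R \<phi> (Suc k))"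
    using sum_over_index[OF N pos int] by (simp only: slice)
  also have "\<dots> = (LINT \<omega>|M. \<phi> (N \<omega>))"
    by (rule expectation_index[OF N pos \<phi>, symmetric])
  finally show ?thesis by (simp only: \<phi>_def Y_def)
qed

lemma Delta_eq_kolmogorov_dist:
  assumes "(\<lambda>\<omega>. S X (N \<omega>) \<omega> / B M X (N \<omega>)) \<in> borel_measurable M"
  shows "Delta M X N = kolmogorov_dist (distr M borel (\<lambda>\<omega>. S X (N \<omega>) \<omega> / B M X (N \<omega>)))"
proof -
  have "measure M {\<omega> \<in> space M. S X (N \<omega>) \<omega> / B M X (N \<omega>) < x}
      = lcdf (distr M borel (\<lambda>\<omega>. S X (N \<omega>) \<omega> / B M X (N \<omega>))) x" for x
    unfolding lcdf_def using assms
    by (subst measure_distr) (auto intro!: arg_cong[of _ _ "measure M"])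
  then show ?thesis unfolding Delta_def kolmogorov_dist_def by simp
qed

section \<open>The random central limit theorem\<close>

theorem theorem3p1:
  fixes M :: "'a measure"
    and X :: "nat \<Rightarrow> 'a \<Rightarrow> real"
    and \<nu> :: "nat \<Rightarrow> 'a \<Rightarrow> nat"
  assumes prob: "prob_space M"
    and indep_X: "prob_space.indep_vars M (\<lambda>_. borel) X {1..}"
    and finite_variance: "\<And>j. j \<ge> 1 \<Longrightarrow> integrable M (\<lambda>\<omega>. (X j \<omega>)\<^sup>2)"
    and centred: "\<And>j. j \<ge> 1 \<Longrightarrow> prob_space.expectation M (X j) = 0"
    and variance_pos: "\<And>j. j \<ge> 1 \<Longrightarrow> var M (X j) > 0"
    and B_pos: "\<And>n. n \<ge> 1 \<Longrightarrow> B M X n > 0"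
    and B_infinity: "filterlim (B M X) at_top sequentially"
    and nu_measurable: "\<And>n. n \<ge> 1 \<Longrightarrow> \<nu> n \<in> measurable M (count_space UNIV)"
    and nu_pos: "\<And>n \<omega>. n \<ge> 1 \<Longrightarrow> \<omega> \<in> space M \<Longrightarrow> \<nu> n \<omega> \<ge> 1"
    and nu_indep: "\<And>n. n \<ge> 1 \<Longrightarrow> indep_with_index M (\<nu> n) X"
    and nu_infinity: "tends_to_infinity_in_prob M (\<lambda>n \<omega>. real (\<nu> n \<omega>))"
    and B_nu_pos: "\<And>n. n \<ge> 1 \<Longrightarrow> AE \<omega> in M. B M X (\<nu> n \<omega>) > 0"
    and B_nu_infinity: "tends_to_infinity_in_prob M (\<lambda>n \<omega>. B M X (\<nu> n \<omega>))"
  shows "(random_rotar_condition M X \<nu> \<longrightarrow> (\<lambda>n. Delta M X (\<nu> n)) \<longlonglongrightarrow> 0) \<and>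
         (random_feller_condition M X \<nu> \<and> (\<lambda>n. Delta M X (\<nu> n)) \<longlonglongrightarrow> 0
            \<longrightarrow> random_rotar_condition M X \<nu>)"
proof -
  interpret prob_space M by (rule prob)
  have X: "X j \<in> borel_measurable M" if "1 \<le> j" for j
    using indep_X that unfolding indep_vars_def by auto
  define \<mu> where "\<mu> j = distr M borel (X j)" for j
  define s where "s j = sqrt (var M (X j))" for j
  have s_pos: "0 < s j" and s_sq: "(s j)\<^sup>2 = var M (X j)" if "1 \<le> j" for j
    using variance_pos[OF that] by (auto simp: s_def)
  have \<mu>: "real_distribution (\<mu> j)" "integrable (\<mu> j) (\<lambda>y. y\<^sup>2)"
    "(LINT y|\<mu> j. y) = 0" "(LINT y|\<mu> j. y\<^sup>2) = (s j)\<^sup>2" if j: "1 \<le> j" for j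
    using X[OF j] finite_variance[OF j] centred[OF j] unfolding s_sq[OF j]
    by (auto simp: \<mu>_def var_def integrable_distr_eq integral_distr real_distribution_distr)
  have B_sq: "(\<Sum>j=1..k. (s j)\<^sup>2) = (B M X k)\<^sup>2" for k
  proof -
    have "0 \<le> (\<Sum>j=1..k. var M (X j))" using variance_pos by (intro sum_nonneg less_imp_le) auto
    then show ?thesis by (simp add: B_def s_sq)
  qed

  define \<phi> where "\<phi> t k = (\<Prod>j=1..k. char (\<mu> j) (t / B M X k))" for t k
  define feller where "feller k = 1 / (B M X k)\<^sup>2 * Max ((\<lambda>j. var M (X j)) ` {1..k})" for k
  have rotar_eq: "rotar M X \<epsilon> k
      = 1 / (B M X k)\<^sup>2 * (\<Sum>j=1..k. cdf_gap (\<mu> j) (centred_normal (s j)) (\<epsilon> * B M X k))" for \<epsilon> k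
  proof -
    have "F M X j x = lcdf (\<mu> j) x" "Phi M X j x = lcdf (centred_normal (s j)) x" if j: "1 \<le> j" for j x
      using X[OF j] lcdf_centred_normal[OF s_pos[OF j]]
      by (auto simp: F_def lcdf_def \<mu>_def Phi_def s_def measure_distr intro!: arg_cong[of _ _ "measure M"])
    then show ?thesis unfolding rotar_def cdf_gap_def by simp
  qed
  have gap: "0 \<le> cdf_gap (\<mu> j) (centred_normal (s j)) a"
    "cdf_gap (\<mu> j) (centred_normal (s j)) a \<le> 4 * (s j)\<^sup>2" if j: "1 \<le> j" for j a
  proof -
    have le: "(LINT y|\<rho>. y\<^sup>2 * indicator {y. a < \<bar>y\<bar>} y) \<le> (LINT y|\<rho>. y\<^sup>2)"
      if "real_distribution \<rho>" "integrable \<rho> (\<lambda>y. y\<^sup>2)" for \<rho> :: "real measure"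
    proof -
      interpret R: real_distribution \<rho> by fact
      show ?thesis
        by (intro integral_mono Bochner_Integration.integrable_bound[OF that(2)] that(2))
           (auto split: split_indicator)
    qed
    note b = \<mu>(1,2)[OF j] real_distribution_centred_normal moments_centred_normal(1)
    show "0 \<le> cdf_gap (\<mu> j) (centred_normal (s j)) a" by (rule cdf_gap_bound(3)[OF b])
    show "cdf_gap (\<mu> j) (centred_normal (s j)) a \<le> 4 * (s j)\<^sup>2"
      using cdf_gap_bound(2)[OF b, of "s j" a] le[OF b(1,2)] le[OF b(3,4), of "s j"]
      unfolding \<mu>(4)[OF j] moments_centred_normal(3) by linarith
  qed
  have rotar_bounds: "0 \<le> rotar M X \<epsilon> k" "rotar M X \<epsilon> k \<le> 4" if k: "1 \<le> k" for \<epsilon> k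
  proof -
    show "0 \<le> rotar M X \<epsilon> k" unfolding rotar_eq by (intro mult_nonneg_nonneg sum_nonneg gap) auto
    have "rotar M X \<epsilon> k \<le> 1 / (B M X k)\<^sup>2 * (\<Sum>j=1..k. 4 * (s j)\<^sup>2)"
      unfolding rotar_eq by (intro mult_left_mono sum_mono gap) auto
    also have "\<dots> = 4" unfolding sum_distrib_left[symmetric] B_sq using B_pos[OF k] by simp
    finally show "rotar M X \<epsilon> k \<le> 4" .
  qed
  have feller_ge: "1 / (B M X k)\<^sup>2 * (s j)\<^sup>2 \<le> feller k" if "j \<in> {1..k}" for j k
    unfolding feller_def using that by (intro mult_left_mono) (auto simp: s_sq)
  have feller_bounds: "0 \<le> feller k" "feller k \<le> 1" if k: "1 \<le> k" for k
  proof -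
    have "Max ((\<lambda>j. var M (X j)) ` {1..k}) \<in> (\<lambda>j. var M (X j)) ` {1..k}"
      using k by (intro Max_in) auto
    then obtain j where j: "j \<in> {1..k}" "Max ((\<lambda>j. var M (X j)) ` {1..k}) = (s j)\<^sup>2" by (auto simp: s_sq)
    have "(s j)\<^sup>2 \<le> (B M X k)\<^sup>2"
      unfolding B_sq[symmetric] using j(1) by (intro member_le_sum) auto
    then show "0 \<le> feller k" "feller k \<le> 1" unfolding feller_def j(2) using B_pos[OF k] by auto
  qed
  have \<phi>_le: "cmod (\<phi> t k) \<le> 1" for t k
    unfolding \<phi>_def prod_norm[symmetric]
    by (intro prod_le_1) (auto intro!: real_distribution.cmod_char_le_1 \<mu>)

  \<comment> \<open>The hypotheses on \<open>\<nu> n\<close> hold from \<open>n = 1\<close> on, so the laws are indexed from the successor.\<close>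
  define P where "P n = distr M borel (\<lambda>\<omega>. S X (\<nu> (Suc n) \<omega>) \<omega> / B M X (\<nu> (Suc n) \<omega>))" for n
  have N: "\<nu> (Suc n) \<in> measurable M (count_space UNIV)" "\<And>\<omega>. \<omega> \<in> space M \<Longrightarrow> 1 \<le> \<nu> (Suc n) \<omega>"
    "indep_with_index M (\<nu> (Suc n)) X" for n
    using nu_measurable nu_pos nu_indep by simp_all
  note Y = borel_measurable_random_sum[OF X N(1)]
  have P: "real_distribution (P n)" for n unfolding P_def by (rule real_distribution_distr) (rule Y)
  have Delta: "Delta M X (\<nu> (Suc n)) = kolmogorov_dist (P n)" for n
    unfolding P_def by (rule Delta_eq_kolmogorov_dist) (rule Y)
  have char_P: "char (P n) t = (LINT \<omega>|M. \<phi> t (\<nu> (Suc n) \<omega>))" for n t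
    unfolding P_def \<phi>_def \<mu>_def by (rule char_random_sum[OF X N])
  have int_\<phi>: "integrable M (\<lambda>\<omega>. \<phi> t (\<nu> (Suc n) \<omega>))" for n t
    by (rule integrable_index[OF N(1,2) \<phi>_le])
  have int_rotar: "integrable M (\<lambda>\<omega>. rotar M X \<epsilon> (\<nu> (Suc n) \<omega>))" for n \<epsilon>
    by (rule integrable_index[OF N(1,2), where C = 4]) (use rotar_bounds in auto)
  have int_feller: "integrable M (\<lambda>\<omega>. feller (\<nu> (Suc n) \<omega>))" for n
    by (rule integrable_index[OF N(1,2), where C = 1]) (use feller_bounds in auto)
  have rotar_E: "expect_at M (\<nu> (Suc n)) (rotar M X \<epsilon>) = (LINT \<omega>|M. rotar M X \<epsilon> (\<nu> (Suc n) \<omega>))" for n \<epsilon>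
    by (rule expect_at_eq_expectation[OF N(1,2), where C = 4]) (use rotar_bounds in auto)
  have feller_E: "expect_at M (\<nu> (Suc n)) feller = (LINT \<omega>|M. feller (\<nu> (Suc n) \<omega>))" for n
    by (rule expect_at_eq_expectation[OF N(1,2), where C = 1]) (use feller_bounds in auto)
  have Delta_iff: "(\<lambda>n. Delta M X (\<nu> n)) \<longlonglongrightarrow> 0 \<longleftrightarrow> (\<forall>t. (\<lambda>n. char (P n) t) \<longlonglongrightarrow> exp (- (t\<^sup>2 / 2)))"
    unfolding filterlim_sequentially_Suc[of "\<lambda>n. Delta M X (\<nu> n)", symmetric] Delta
    by (rule kolmogorov_dist_tendsto_0_iff[OF P])

  have char_close: "cmod (char (P n) t - exp (- (t\<^sup>2 / 2)))
      \<le> 2 * \<bar>t\<bar>^3 * \<epsilon> + 2 * t\<^sup>2 * expect_at M (\<nu> (Suc n)) (rotar M X \<epsilon>)" if \<epsilon>: "0 < \<epsilon>" for n t \<epsilon>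
  proof -
    have "char (P n) t - exp (- (t\<^sup>2 / 2)) = (LINT \<omega>|M. \<phi> t (\<nu> (Suc n) \<omega>) - exp (- (t\<^sup>2 / 2)))"
      unfolding char_P using int_\<phi>[of t n] prob_space by simp
    then have "cmod (char (P n) t - exp (- (t\<^sup>2 / 2)))
        = cmod (LINT \<omega>|M. \<phi> t (\<nu> (Suc n) \<omega>) - exp (- (t\<^sup>2 / 2)))" by (simp only:)
    also have "\<dots> \<le> (LINT \<omega>|M. 2 * \<bar>t\<bar>^3 * \<epsilon> + 2 * t\<^sup>2 * rotar M X \<epsilon> (\<nu> (Suc n) \<omega>))"
    proof (rule order_trans[OF integral_norm_bound integral_mono])
      show "integrable M (\<lambda>\<omega>. cmod (\<phi> t (\<nu> (Suc n) \<omega>) - exp (- (t\<^sup>2 / 2))))"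
        by (intro integrable_norm Bochner_Integration.integrable_diff int_\<phi>) auto
      show "integrable M (\<lambda>\<omega>. 2 * \<bar>t\<bar>^3 * \<epsilon> + 2 * t\<^sup>2 * rotar M X \<epsilon> (\<nu> (Suc n) \<omega>))"
        by (intro Bochner_Integration.integrable_add integrable_mult_right int_rotar) auto
      fix \<omega> assume "\<omega> \<in> space M"
      then have k: "1 \<le> \<nu> (Suc n) \<omega>" by (rule N(2))
      show "cmod (\<phi> t (\<nu> (Suc n) \<omega>) - exp (- (t\<^sup>2 / 2)))
          \<le> 2 * \<bar>t\<bar>^3 * \<epsilon> + 2 * t\<^sup>2 * rotar M X \<epsilon> (\<nu> (Suc n) \<omega>)"
        unfolding \<phi>_def rotar_eq
        by (rule prod_char_diff_le) (use \<mu> B_sq B_pos[OF k] \<epsilon> in auto)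
    qed
    also have "\<dots> = 2 * \<bar>t\<bar>^3 * \<epsilon> + 2 * t\<^sup>2 * expect_at M (\<nu> (Suc n)) (rotar M X \<epsilon>)"
      unfolding rotar_E using int_rotar[of \<epsilon> n] prob_space by simp
    finally show ?thesis .
  qed

  have sufficiency: "(\<lambda>n. Delta M X (\<nu> n)) \<longlonglongrightarrow> 0" if R: "random_rotar_condition M X \<nu>"
    unfolding Delta_iff
  proof (intro allI tendstoI)
    fix t e :: real assume e: "0 < e"
    \<comment> \<open>The level is chosen so that the part of \<open>char_close\<close> free of the Rotar quantity is at most \<open>e / 2\<close>; the summand \<open>1\<close> covers \<open>t = 0\<close>.\<close>
    define \<epsilon> where "\<epsilon> = e / (2 * (2 * \<bar>t\<bar>^3 + 1))"
    have \<epsilon>: "0 < \<epsilon>" unfolding \<epsilon>_def using e by (intro divide_pos_pos) (auto intro!: add_nonneg_pos)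
    have small: "2 * \<bar>t\<bar>^3 * \<epsilon> \<le> e / 2"
    proof -
      have "2 * \<bar>t\<bar>^3 * \<epsilon> \<le> (2 * \<bar>t\<bar>^3 + 1) * \<epsilon>" using \<epsilon> by (intro mult_right_mono) auto
      also have "\<dots> = e / 2"
      proof -
        have "0 < 2 * \<bar>t\<bar>^3 + 1" by (intro add_nonneg_pos) auto
        then show ?thesis unfolding \<epsilon>_def by (simp add: field_simps)
      qed
      finally show ?thesis .
    qed
    have "(\<lambda>n. expect_at M (\<nu> (Suc n)) (rotar M X \<epsilon>)) \<longlonglongrightarrow> 0"
      using R \<epsilon> unfolding random_rotar_condition_def
      by (intro LIMSEQ_Suc[of "\<lambda>n. expect_at M (\<nu> n) (rotar M X \<epsilon>)"]) auto
    then have "(\<lambda>n. 2 * t\<^sup>2 * expect_at M (\<nu> (Suc n)) (rotar M X \<epsilon>)) \<longlonglongrightarrow> 0"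
      by (rule tendsto_mult_right_zero)
    then have "\<forall>\<^sub>F n in sequentially. 2 * t\<^sup>2 * expect_at M (\<nu> (Suc n)) (rotar M X \<epsilon>) < e / 2"
      by (rule order_tendstoD(2)) (use e in simp)
    then show "\<forall>\<^sub>F n in sequentially. dist (char (P n) t) (complex_of_real (exp (- (t\<^sup>2 / 2)))) < e"
    proof eventually_elim
      case (elim n)
      then show ?case using char_close[OF \<epsilon>, of n t] small by (simp add: dist_norm)
    qed
  qed

  have necessity: "random_rotar_condition M X \<nu>"
    if Fe: "random_feller_condition M X \<nu>" and D: "(\<lambda>n. Delta M X (\<nu> n)) \<longlonglongrightarrow> 0"
    unfolding random_rotar_condition_def
  proof (intro allI impI)
    fix \<epsilon> :: real assume \<epsilon>: "0 < \<epsilon>"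
    define a where "a = 8 * (40 / min (\<epsilon>\<^sup>2) 9)"
    define b where "b = 4 * (40 / min (\<epsilon>\<^sup>2) 9) * exp (1/2) + 6 / \<epsilon>\<^sup>2"
    have le: "expect_at M (\<nu> (Suc n)) (rotar M X \<epsilon>)
        \<le> a * (exp (1/2) * Re (char (P n) 1) - 1) + b * expect_at M (\<nu> (Suc n)) feller" for n
    proof -
      have int_Re: "integrable M (\<lambda>\<omega>. Re (\<phi> 1 (\<nu> (Suc n) \<omega>)))" by (intro integrable_Re int_\<phi>)
      have "expect_at M (\<nu> (Suc n)) (rotar M X \<epsilon>)
          \<le> (LINT \<omega>|M. a * (exp (1/2) * Re (\<phi> 1 (\<nu> (Suc n) \<omega>)) - 1) + b * feller (\<nu> (Suc n) \<omega>))"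
        unfolding rotar_E
      proof (rule integral_mono[OF int_rotar])
        show "integrable M (\<lambda>\<omega>. a * (exp (1/2) * Re (\<phi> 1 (\<nu> (Suc n) \<omega>)) - 1) + b * feller (\<nu> (Suc n) \<omega>))"
          by (intro Bochner_Integration.integrable_add Bochner_Integration.integrable_diff
              integrable_mult_right int_Re int_feller) auto
        fix \<omega> assume "\<omega> \<in> space M"
        then have k: "1 \<le> \<nu> (Suc n) \<omega>" by (rule N(2))
        show "rotar M X \<epsilon> (\<nu> (Suc n) \<omega>) \<le> a * (exp (1/2) * Re (\<phi> 1 (\<nu> (Suc n) \<omega>)) - 1) + b * feller (\<nu> (Suc n) \<omega>)"
          unfolding \<phi>_def rotar_eq a_def b_def
          by (rule sum_cdf_gap_le[OF \<mu>]) (use B_sq B_pos[OF k] \<epsilon> feller_ge in auto)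
      qed
      also have "\<dots> = a * (exp (1/2) * (LINT \<omega>|M. Re (\<phi> 1 (\<nu> (Suc n) \<omega>))) - 1) + b * (LINT \<omega>|M. feller (\<nu> (Suc n) \<omega>))"
        using int_Re int_feller prob_space by simp
      also have "(LINT \<omega>|M. Re (\<phi> 1 (\<nu> (Suc n) \<omega>))) = Re (char (P n) 1)"
        unfolding char_P by (rule integral_Re[OF int_\<phi>])
      finally show ?thesis unfolding feller_E .
    qed
    have "(\<lambda>n. char (P n) 1) \<longlonglongrightarrow> complex_of_real (exp (- (1\<^sup>2 / 2)))" using D unfolding Delta_iff by blast
    from tendsto_Re[OF this] have Re_lim: "(\<lambda>n. Re (char (P n) 1)) \<longlonglongrightarrow> exp (- (1 / 2))" by simp
    have feller_lim: "(\<lambda>n. expect_at M (\<nu> (Suc n)) feller) \<longlonglongrightarrow> 0"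
      using Fe unfolding random_feller_condition_def feller_def[abs_def] by (rule LIMSEQ_Suc)
    have "(\<lambda>n. a * (exp (1/2) * Re (char (P n) 1) - 1) + b * expect_at M (\<nu> (Suc n)) feller)
        \<longlonglongrightarrow> a * (exp (1/2) * exp (- (1 / 2)) - 1) + b * 0"
      by (intro tendsto_intros Re_lim feller_lim)
    also have "a * (exp (1/2) * exp (- (1 / 2)) - 1) + b * 0 = 0" by (simp flip: exp_add)
    finally have "(\<lambda>n. expect_at M (\<nu> (Suc n)) (rotar M X \<epsilon>)) \<longlonglongrightarrow> 0"
    proof (rule Lim_null_comparison[rotated])
      have "0 \<le> expect_at M (\<nu> (Suc n)) (rotar M X \<epsilon>)" for n
        unfolding rotar_E using N(2) rotar_bounds(1) by (intro integral_nonneg_AE AE_I2) auto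
      then show "\<forall>\<^sub>F n in sequentially. norm (expect_at M (\<nu> (Suc n)) (rotar M X \<epsilon>))
          \<le> a * (exp (1/2) * Re (char (P n) 1) - 1) + b * expect_at M (\<nu> (Suc n)) feller"
        using le by auto
    qed
    then show "(\<lambda>n. expect_at M (\<nu> n) (rotar M X \<epsilon>)) \<longlonglongrightarrow> 0"
      by (rule LIMSEQ_imp_Suc)
  qed
  show ?thesis using sufficiency necessity by blast
qed

end
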